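(* For $n\ge1$ let $P_{n}(s,y,t)=P_{n}^{(\mathrm{udr},\mathrm{ipk},\mathrm{ides})}(s,y,t)=\sum_{\pi\in\mathfrak{S}_{n}}s^{\mathrm{udr}(\pi)}y^{\mathrm{ipk}(\pi)+1}t^{\mathrm{ides}(\pi)+1}$. Then: (a) As formal power series, \begin{multline*} \frac{1}{(1-s)(1-t)}+\sum_{n=1}^{\infty}\frac{(1+s^{2})^{n}}{(1-s^{2})^{n-1}}\left(\frac{1+yt}{1-t}\right)^{n+1}\frac{P_{n}\left(\frac{2s}{1+s^{2}},\frac{(1+y)^{2}t}{(y+t)(1+yt)},\frac{y+t}{1+yt}\right)}{2(1-s)^{2}(1+y)}x^{n}\\ =\sum_{i,j=0}^{\infty}\left(\frac{(1+x)(1+yx)}{(1-yx)(1-x)}\right)^{ij}\left(1+s\left(\frac{1+yx}{1-x}\right)^{j}\right)s^{2i}t^{j}. \end{multline*} (b) For all $n\geq1$, \begin{multline*} \frac{(1+s^{2})^{n}}{(1-s^{2})^{n-1}}\left(\frac{1+yt}{1-t}\right)^{n+1}\frac{P_{n}\left(\frac{2s}{1+s^{2}},\frac{(1+y)^{2}t}{(y+t)(1+yt)},\frac{y+t}{1+yt}\right)}{2(1-s)^{2}(1+y)}\\ =\sum_{\substack{\lambda\vdash n\\ \text{all parts odd}}}\frac{2^{l(\lambda)}}{z_{\lambda}}\frac{A_{l(\lambda)}(s^{2})A_{l(\lambda)}(t)}{(1-s^{2})^{l(\lambda)+1}(1-t)^{l(\lambda)+1}}\prod_{k=1}^{l(\lambda)}(1-(-y)^{\lambda_{k}})\\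 +s\sum_{\lambda\vdash n}\frac{1}{z_{\lambda}}\frac{B_{o(\lambda)}(s^{2})A_{l(\lambda)}(t)}{(1-s^{2})^{o(\lambda)+1}(1-t)^{l(\lambda)+1}}\prod_{k=1}^{l(\lambda)}(1-(-y)^{\lambda_{k}}), \end{multline*} where $\lambda_1,\dots,\lambda_{l(\lambda)}$ are the parts of $\lambda$.
   Context: $\mathfrak{S}_n$ is the symmetric group on $[n]$. For $\pi\in\mathfrak{S}_n$: $i\in[n-1]$ is a descent if $\pi(i)>\pi(i+1)$, $\mathrm{des}(\pi)$ the number of descents, $\mathrm{ides}(\pi)=\mathrm{des}(\pi^{-1})$; $i$ with $2\le i\le n-1$ is a peak if $\pi(i-1)<\pi(i)>\pi(i+1)$, $\mathrm{pk}(\pi)$ the number of peaks, $\mathrm{ipk}(\pi)=\mathrm{pk}(\pi^{-1})$. A birun of $\pi$ (in one-line notation) is a maximal monotone consecutive subsequence; an up-down run is a birun or the one-element subsequence $\pi(1)$ when $\pi(1)>\pi(2)$; $\mathrm{udr}(\pi)$ is the number of up-down runs. $A_n(t)=\sum_{\pi\in\mathfrak{S}_n}t^{\mathrm{des}(\pi)+1}$ for $n\ge1$, $A_0=1$; $B_n(t)$ is defined by $\frac{B_n(t)}{(1-t)^{n+1}}=\sum_{k\ge0}(2k+1)^nt^k$. For a partition $\lambda$: $l(\lambda)$ is the number of parts, $o(\lambda)$ the number of odd parts, and if $\lambda$ has $m_i$ parts equal to $i$ then $z_\lambda=\prod_i i^{m_i}m_i!$. *)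

theory Defs
  imports
    "HOL-Combinatorics.Permutations"
    "HOL-Library.Multiset"
    "HOL-Computational_Algebra.Formal_Power_Series"
    "HOL-Computational_Algebra.Formal_Laurent_Series"
begin

text \<open>
  A permutation of \<open>[n]\<close> is a function \<open>\<pi>\<close> with \<open>\<pi> permutes {1..n}\<close>; its length \<open>n\<close> is passed
  to the statistics explicitly.
\<close>

definition des :: "nat \<Rightarrow> (nat \<Rightarrow> nat) \<Rightarrow> nat" where
  "des n \<pi> = card {i. 1 \<le> i \<and> i < n \<and> \<pi> i > \<pi> (i + 1)}"

definition ides :: "nat \<Rightarrow> (nat \<Rightarrow> nat) \<Rightarrow> nat" where
  "ides n \<pi> = des n (inv \<pi>)"

definition pk :: "nat \<Rightarrow> (nat \<Rightarrow> nat) \<Rightarrow> nat" where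
  "pk n \<pi> = card {i. 2 \<le> i \<and> i < n \<and> \<pi> (i - 1) < \<pi> i \<and> \<pi> i > \<pi> (i + 1)}"

definition ipk :: "nat \<Rightarrow> (nat \<Rightarrow> nat) \<Rightarrow> nat" where
  "ipk n \<pi> = pk n (inv \<pi>)"

text \<open>
  The pair \<open>(a, b)\<close> with \<open>1 \<le> a \<le> b \<le> n\<close> stands for the consecutive subsequence
  \<open>\<pi>(a), \<dots>, \<pi>(b)\<close>.
\<close>

definition monotone_segments :: "nat \<Rightarrow> (nat \<Rightarrow> nat) \<Rightarrow> (nat \<times> nat) set" where
  "monotone_segments n \<pi> = {(a, b). 1 \<le> a \<and> a \<le> b \<and> b \<le> n \<and>
     (strict_mono_on {a..b} \<pi> \<or> strict_antimono_on {a..b} \<pi>)}"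

definition biruns :: "nat \<Rightarrow> (nat \<Rightarrow> nat) \<Rightarrow> (nat \<times> nat) set" where
  "biruns n \<pi> = {(a, b) \<in> monotone_segments n \<pi>.
     \<forall>(c, d) \<in> monotone_segments n \<pi>. {a..b} \<subseteq> {c..d} \<longrightarrow> (c, d) = (a, b)}"

definition up_down_runs :: "nat \<Rightarrow> (nat \<Rightarrow> nat) \<Rightarrow> (nat \<times> nat) set" where
  "up_down_runs n \<pi> = biruns n \<pi> \<union> (if 2 \<le> n \<and> \<pi> 1 > \<pi> 2 then {(1, 1)} else {})"

definition udr :: "nat \<Rightarrow> (nat \<Rightarrow> nat) \<Rightarrow> nat" where
  "udr n \<pi> = card (up_down_runs n \<pi>)"

text \<open>
  The polynomials \<open>P\<^sub>n\<close> and \<open>A\<^sub>n\<close> are given as polynomial functions on an arbitrary commutative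
  ring, so that substitution is function application.
\<close>

definition P_udr_ipk_ides :: "nat \<Rightarrow> 'a \<Rightarrow> 'a \<Rightarrow> 'a \<Rightarrow> 'a::comm_ring_1" where
  "P_udr_ipk_ides n s y t =
     (\<Sum>\<pi> | \<pi> permutes {1..n}. s ^ udr n \<pi> * y ^ (ipk n \<pi> + 1) * t ^ (ides n \<pi> + 1))"

definition eulerian_A :: "nat \<Rightarrow> 'a \<Rightarrow> 'a::comm_ring_1" where
  "eulerian_A n t = (if n = 0 then 1 else (\<Sum>\<pi> | \<pi> permutes {1..n}. t ^ (des n \<pi> + 1)))"

text \<open>
  \<open>B\<^sub>n\<close> as a series in its own variable; \<open>B\<^sub>n(f)\<close>, for \<open>f\<close> without constant term,
  is \<open>eulerian_B n oo f\<close>.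
\<close>

definition eulerian_B :: "nat \<Rightarrow> 'a::comm_ring_1 fps" where
  "eulerian_B n = Abs_fps (\<lambda>k. (2 * of_nat k + 1) ^ n) * (1 - fps_X) ^ (n + 1)"

text \<open>A partition is the multiset of its parts.\<close>

definition partitions_of :: "nat \<Rightarrow> nat multiset set" where
  "partitions_of n = {p. 0 \<notin># p \<and> sum_mset p = n}"

definition num_odd_parts :: "nat multiset \<Rightarrow> nat" where
  "num_odd_parts p = size (filter_mset odd p)"

definition z_part :: "nat multiset \<Rightarrow> nat" where
  "z_part p = (\<Prod>i\<in>set_mset p. i ^ count p i * fact (count p i))"

text \<open>
  The identities are stated in \<open>\<rat>((y))[[x]][[t]][[s]]\<close>, which contains \<open>\<rat>[[x,y,t,s]]\<close>. Laurent series
  in \<open>y\<close> are used because the substituted arguments of \<open>P\<^sub>n\<close> have the denominator \<open>y + t\<close>, which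
  is a unit here but not in \<open>\<rat>[[y,t]]\<close>.
\<close>

type_synonym series = "rat fls fps fps fps"

text \<open>
  Division by a series whose constant coefficient (an element of \<open>\<rat>((y))\<close>) is nonzero is true
  division in the iterated power series ring.
\<close>

lemma series_divide_mult_cancel:
  fixes f g :: series
  assumes "g $ 0 $ 0 $ 0 \<noteq> 0"
  shows "f / g * g = f"
proof -
  have 1: "g $ 0 $ 0 * inverse (g $ 0 $ 0) = 1"
    using assms by (simp add: inverse_mult_eq_1')
  have 2: "g $ 0 * inverse (g $ 0) = 1"
    using fps_right_inverse[OF 1] by (simp only: fps_inverse_def[of "g $ 0"])
  have 3: "g * inverse g = 1"
    using fps_right_inverse[OF 2] by (simp only: fps_inverse_def[of "g"])
  have "subdegree g = 0"
    using assms by (intro subdegree_eq_0) auto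
  then have "f / g = f * inverse g"
    by (simp add: fps_divide_def)
  then show ?thesis
    using 3 by (simp add: mult.assoc mult.commute[of "inverse g"])
qed

text \<open>
  Infinite sums of multivariate power series are taken coefficientwise: for each monomial in
  \<open>s, t, x\<close> only finitely many summands may contribute. (The metric topology on the type
  constructor \<open>fps\<close> would only see the outermost variable.)
\<close>

definition formally_summable_on :: "('i \<Rightarrow> series) \<Rightarrow> 'i set \<Rightarrow> bool" where
  "formally_summable_on f I \<longleftrightarrow> (\<forall>a b c. finite {i \<in> I. f i $ a $ b $ c \<noteq> 0})"

definition formal_sum :: "('i \<Rightarrow> series) \<Rightarrow> 'i set \<Rightarrow> series" where
  "formal_sum f I = Abs_fps (\<lambda>a. Abs_fps (\<lambda>b. Abs_fps (\<lambda>c.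
     \<Sum>i | i \<in> I \<and> f i $ a $ b $ c \<noteq> 0. f i $ a $ b $ c)))"

end

theory Submission
  imports Defs
begin

text \<open>
  A filling of \<open>\<pi>\<close> by an ordered alphabet of barred and unbarred letters is a weakly increasing word
  that is constant only along ascents for unbarred letters and only along descents for barred ones.
  With \<open>a\<close> letters, alternately unbarred and barred, the generating function over \<open>a\<close> of the number
  of fillings depends on \<open>\<pi>\<close> only through \<open>udr\<close>; with \<open>j\<close> pairs of a barred letter of weight \<open>y\<close>
  and an unbarred one, the generating function over \<open>j\<close> depends only on \<open>pk\<close> and \<open>des\<close>. Both have the
  closed forms that appear on the left-hand side of the theorem.

  Filling \<open>\<pi>\<close> with the first alphabet and its inverse with the second amounts, by standardization,
  to a chain in the product of the two alphabets, where the sign of a pair is the product of the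
  signs. The generating function of such chains is the product of \<open>1 / (1 - w x)\<close> over the unbarred
  and \<open>1 + w x\<close> over the barred pairs, which gives (a). For (b) one expands this product by the
  exponential formula and sums over \<open>i\<close> and \<open>j\<close> with the Eulerian polynomials, whose generating
  function is again a count of fillings, this time with unbarred letters only.
\<close>

section \<open>Chains\<close>

text \<open>The relation may depend on the position because a filling repeats letters differently at
  ascents and at descents. Extensional functions make a chain the same as its list of
  values.\<close>

definition rel_chains :: "nat \<Rightarrow> 'b set \<Rightarrow> (nat \<Rightarrow> 'b \<Rightarrow> 'b \<Rightarrow> bool) \<Rightarrow> (nat \<Rightarrow> 'b) set" where
  "rel_chains n S r = {f \<in> {1..n} \<rightarrow>\<^sub>E S. \<forall>i\<in>{1..<n}. r i (f i) (f (Suc i))}"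

definition chain_sum ::
    "nat \<Rightarrow> 'b set \<Rightarrow> (nat \<Rightarrow> 'b \<Rightarrow> 'b \<Rightarrow> bool) \<Rightarrow> ('b \<Rightarrow> 'a) \<Rightarrow> 'a::comm_ring_1" where
  "chain_sum n S r w = (\<Sum>f\<in>rel_chains n S r. \<Prod>i=1..n. w (f i))"

text \<open>The part of \<^term>\<open>chain_sum (Suc n) S r w\<close> contributed by the chains that end in \<open>z\<close>.\<close>

definition chain_end ::
    "nat \<Rightarrow> 'b set \<Rightarrow> (nat \<Rightarrow> 'b \<Rightarrow> 'b \<Rightarrow> bool) \<Rightarrow> ('b \<Rightarrow> 'a) \<Rightarrow> 'b \<Rightarrow> 'a::comm_ring_1" where
  "chain_end n S r w z =
     w z * (\<Sum>f | f \<in> rel_chains n S r \<and> (n = 0 \<or> r n (f n) z). \<Prod>i=1..n. w (f i))"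

lemma finite_chains: "finite S \<Longrightarrow> finite (rel_chains n S r)"
  unfolding rel_chains_def by (rule finite_subset[of _ "{1..n} \<rightarrow>\<^sub>E S"]) (auto intro: finite_PiE)

lemma chain_sum_0 [simp]: "chain_sum 0 S r w = 1"
proof -
  have "rel_chains 0 S r = {\<lambda>_. undefined}"
    by (auto simp: rel_chains_def)
  then show ?thesis by (simp add: chain_sum_def)
qed

text \<open>Deleting the last entry, that is resetting it to \<open>undefined\<close>, is a
  bijection onto pairs of a last letter and a shorter chain. The predicate \<open>Q\<close> is
  trivial for the full sum and is the next link of the chain in the recurrence for
  \<open>chain_end\<close>.\<close>

lemma sum_chains_last:
  assumes "finite S"
  shows "(\<Sum>f | f \<in> rel_chains (Suc n) S r \<and> Q (f (Suc n)). \<Prod>i=1..Suc n. w (f i)) =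
         (\<Sum>z | z \<in> S \<and> Q z. chain_end n S r w z)"
proof -
  let ?A = "SIGMA z:{z \<in> S. Q z}. {f \<in> rel_chains n S r. n = 0 \<or> r n (f n) z}"
  have "(\<Sum>f | f \<in> rel_chains (Suc n) S r \<and> Q (f (Suc n)). \<Prod>i=1..Suc n. w (f i)) =
        (\<Sum>(z, f)\<in>?A. w z * (\<Prod>i=1..n. w (f i)))"
  proof (rule sum.reindex_bij_witness[where i = "\<lambda>(z, f). f(Suc n := z)"
        and j = "\<lambda>f. (f (Suc n), f(Suc n := undefined))"], goal_cases)
    case (1 f)
    then show ?case by simp
  next
    case (2 f)
    then show ?case
      by (auto simp: rel_chains_def PiE_iff extensional_def)
  next
    case (3 p)
    then show ?case
      by (auto simp: rel_chains_def PiE_iff extensional_def fun_eq_iff)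
  next
    case (4 p)
    obtain z f where p: "p = (z, f)" by (cases p)
    then have "z \<in> S" "Q z" "f \<in> {1..n} \<rightarrow>\<^sub>E S" "\<And>i. i \<in> {1..<n} \<Longrightarrow> r i (f i) (f (Suc i))"
      "n = 0 \<or> r n (f n) z"
      using 4 by (auto simp: rel_chains_def)
    moreover have "{1..Suc n} = insert (Suc n) {1..n}" by auto
    ultimately show ?case
      unfolding p rel_chains_def by (auto simp: less_Suc_eq PiE_fun_upd)
  next
    case (5 f)
    have "(\<Prod>i=1..n. w ((f(Suc n := undefined)) i)) = (\<Prod>i=1..n. w (f i))"
      by (rule prod.cong) auto
    then show ?case by (simp add: mult.commute)
  qed
  also have "\<dots> = (\<Sum>z | z \<in> S \<and> Q z. chain_end n S r w z)"
    using assms finite_chains[OF assms]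
    by (subst sum.Sigma[symmetric]) (auto simp: chain_end_def sum_distrib_left)
  finally show ?thesis .
qed

lemma chain_sum_Suc:
  "finite S \<Longrightarrow> chain_sum (Suc n) S r w = (\<Sum>z\<in>S. chain_end n S r w z)"
  using sum_chains_last[where Q = "\<lambda>_. True"] by (simp add: chain_sum_def)

lemma chain_end_0: "chain_end 0 S r w z = w z"
  using chain_sum_0[of S r w] by (simp add: chain_end_def chain_sum_def)

lemma chain_end_Suc:
  "finite S \<Longrightarrow> chain_end (Suc n) S r w z = w z * (\<Sum>u | u \<in> S \<and> r (Suc n) u z. chain_end n S r w u)"
  using sum_chains_last[where Q = "\<lambda>u. r (Suc n) u z" and S = S and n = n and r = r and w = w] by (simp add: chain_end_def)

lemma chain_sum_cong:
  assumes "\<And>i. 1 \<le> i \<Longrightarrow> i < n \<Longrightarrow> r i = r' i"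
  shows "chain_sum n S r w = chain_sum n S r' w"
  unfolding chain_sum_def rel_chains_def using assms by (intro sum.cong) auto

text \<open>A chain that has reached \<open>z\<close> can never return to \<open>S\<close>, so a
  last entry in \<open>S\<close> forces all entries into \<open>S\<close>.\<close>

lemma chains_insert_top:
  assumes top: "\<And>u. u \<in> S \<Longrightarrow> \<not> T z u"
  shows "{f \<in> rel_chains n (insert z S) (\<lambda>_. T). n = 0 \<or> f n \<in> S} = rel_chains n S (\<lambda>_. T)"
proof (intro equalityI subsetI)
  fix f assume f: "f \<in> {f \<in> rel_chains n (insert z S) (\<lambda>_. T). n = 0 \<or> f n \<in> S}"
  have "f (n - i) \<in> S" if "i < n" for i
    using that
  proof (induction i)
    case 0
    then show ?case using f by simp
  next
    case (Suc i)
    then have "f (n - i) \<in> S" "Suc (n - Suc i) = n - i" by auto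
    moreover have "T (f (n - Suc i)) (f (Suc (n - Suc i)))" "f (n - Suc i) \<in> insert z S"
      using f Suc.prems by (auto simp: rel_chains_def PiE_iff)
    ultimately show ?case using top by auto
  qed
  then have "f k \<in> S" if "k \<in> {1..n}" for k
    using that diff_less[of k n] diff_diff_cancel[of k n] by (metis atLeastAtMost_iff less_eq_Suc_le One_nat_def order.strict_trans2)
  then show "f \<in> rel_chains n S (\<lambda>_. T)"
    using f by (auto simp: rel_chains_def PiE_iff)
qed (auto simp: rel_chains_def PiE_iff)

text \<open>Either \<open>z\<close> does not occur at all, or it is the last entry; in the second
  case the earlier entries may use \<open>z\<close> only if \<open>z\<close> is repeatable.\<close>

lemma chain_sum_insert_top:
  assumes S: "finite S" "z \<notin> S" and top: "\<And>u. u \<in> S \<Longrightarrow> T u z \<and> \<not> T z u"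
  shows "chain_sum (Suc n) (insert z S) (\<lambda>_. T) w = chain_sum (Suc n) S (\<lambda>_. T) w +
           w z * chain_sum n (if T z z then insert z S else S) (\<lambda>_. T) w"
proof -
  have *: "{f \<in> rel_chains n (insert z S) (\<lambda>_. T). n = 0 \<or> f n \<in> S} = rel_chains n S (\<lambda>_. T)"
    by (rule chains_insert_top) (use top in auto)
  have last: "f n \<in> insert z S" if "f \<in> rel_chains n (insert z S) (\<lambda>_. T)" "n \<noteq> 0" for f
    using that by (auto simp: rel_chains_def PiE_iff)
  have lastS: "f n \<in> S" if "f \<in> rel_chains n S (\<lambda>_. T)" "n \<noteq> 0" for f
    using that by (auto simp: rel_chains_def PiE_iff)
  have "{f. f \<in> rel_chains n (insert z S) (\<lambda>_. T) \<and> (n = 0 \<or> T (f n) u)} =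
        {f. f \<in> rel_chains n S (\<lambda>_. T) \<and> (n = 0 \<or> T (f n) u)}" if "u \<in> S" for u
    using eqset_imp_iff[OF *] last lastS top that by (intro Collect_cong) auto
  then have 1: "chain_end n (insert z S) (\<lambda>_. T) w u = chain_end n S (\<lambda>_. T) w u" if "u \<in> S" for u
    using that by (simp add: chain_end_def)
  have "{f. f \<in> rel_chains n (insert z S) (\<lambda>_. T) \<and> (n = 0 \<or> T (f n) z)} =
        rel_chains n (if T z z then insert z S else S) (\<lambda>_. T)"
    using * last lastS top by auto
  then have 2: "chain_end n (insert z S) (\<lambda>_. T) w z =
      w z * chain_sum n (if T z z then insert z S else S) (\<lambda>_. T) w"
    by (simp add: chain_end_def chain_sum_def)
  show ?thesis
    using S by (simp add: chain_sum_Suc 1 2 add.commute)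
qed

text \<open>Insert the letters in increasing order of \<open>key\<close>. If H and H' are the
  generating functions before and after adding \<open>z\<close>, of weight w, then H' = H + w X H'
  for a repeatable letter and H' = H + w X H for any other, which yields the two kinds of
  factors.\<close>

lemma chain_sum_gf:
  fixes w :: "'b \<Rightarrow> 'a::field" and key :: "'b \<Rightarrow> nat"
  assumes "finite S" "inj_on key S"
    and "\<And>u v. u \<in> S \<Longrightarrow> v \<in> S \<Longrightarrow> T u v \<longleftrightarrow> key u < key v \<or> u = v \<and> pos u"
  shows "Abs_fps (\<lambda>n. chain_sum n S (\<lambda>_. T) w) =
    (\<Prod>z\<in>S. if pos z then inverse (1 - fps_const (w z) * fps_X) else 1 + fps_const (w z) * fps_X)"
  using assms
proof (induction S rule: finite_ranking_induct[where f = key])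
  case empty
  have "chain_sum n {} (\<lambda>_. T) w = (if n = 0 then 1 else 0)" for n
    by (cases n) (simp_all add: chain_sum_Suc)
  then show ?case by (simp add: fps_eq_iff)
next
  case (insert z S)
  show ?case
  proof (cases "z \<in> S")
    case True
    with insert show ?thesis by (simp add: insert_absorb)
  next
    case False
    have top: "T u z \<and> \<not> T z u" if "u \<in> S" for u
    proof -
      have "key u \<noteq> key z"
        using that False inj_onD[OF insert.prems(1), of u z] by auto
      then show ?thesis
        using insert.hyps(2)[OF that] that insert.prems(2)[of u z] insert.prems(2)[of z u] False
        by auto
    qed
    have zz: "T z z \<longleftrightarrow> pos z"
      using insert.prems(2)[of z z] by simp
    let ?H = "\<lambda>S. Abs_fps (\<lambda>n. chain_sum n S (\<lambda>_. T) w)"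
    have IH: "?H S = (\<Prod>z\<in>S. if pos z then inverse (1 - fps_const (w z) * fps_X)
                              else 1 + fps_const (w z) * fps_X)"
      using insert.prems by (intro insert.IH) (auto intro: inj_on_subset)
    have rec: "?H (insert z S) = ?H S + fps_const (w z) * fps_X * ?H (if pos z then insert z S else S)"
    proof (rule fps_ext)
      fix n show "?H (insert z S) $ n =
          (?H S + fps_const (w z) * fps_X * ?H (if pos z then insert z S else S)) $ n"
        using chain_sum_insert_top[where T = T and n = "n - 1" and w = w, OF insert.hyps(1) False top]
        by (cases n) (simp_all add: zz mult.assoc)
    qed
    show ?thesis
    proof (cases "pos z")
      case True
      let ?q = "1 - fps_const (w z) * fps_X :: 'a fps"
      have "inverse ?q * ?q = 1"
        by (rule inverse_mult_eq_1) simp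
      moreover have "?H S = ?H (insert z S) - fps_const (w z) * fps_X * ?H (insert z S)"
        unfolding eq_diff_eq using rec[symmetric] True by (simp only: if_True)
      then have "?H S = ?q * ?H (insert z S)"
        by (simp only: left_diff_distrib mult_1)
      ultimately have "inverse ?q * ?H S = ?H (insert z S)"
        by (simp only: mult.assoc[symmetric] mult_1)
      then show ?thesis
        using True False insert.hyps(1) IH by (simp only: prod.insert if_True simp_thms)
    next
      case npos: False
      then have "?H (insert z S) = (1 + fps_const (w z) * fps_X) * ?H S"
        using rec by (simp only: if_False distrib_right mult_1)
      then show ?thesis
        using npos False insert.hyps(1) IH by (simp only: prod.insert if_False simp_thms)
    qed
  qed
qed

section \<open>Signed fillings and standardization\<close>

text \<open>
  The letters are natural numbers in their usual order; \<open>\<sigma> k\<close> says that the letter \<open>k\<close> is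
  unbarred, and \<open>b\<close> that there is an ascent between the two positions. An unbarred letter may be
  repeated only along an ascent, a barred one only along a descent.
\<close>

definition letter_rel :: "(nat \<Rightarrow> bool) \<Rightarrow> bool \<Rightarrow> nat \<Rightarrow> nat \<Rightarrow> bool" where
  "letter_rel \<sigma> b k l \<longleftrightarrow> k < l \<or> k = l \<and> \<sigma> l = b"

definition filling_sum ::
    "(nat \<Rightarrow> bool) \<Rightarrow> (nat \<Rightarrow> 'a) \<Rightarrow> nat \<Rightarrow> nat \<Rightarrow> (nat \<Rightarrow> nat) \<Rightarrow> 'a::comm_ring_1" where
  "filling_sum \<sigma> w a n \<pi> = chain_sum n {..<a} (\<lambda>i. letter_rel \<sigma> (\<pi> i < \<pi> (Suc i))) w"

definition std_less :: "(nat \<Rightarrow> bool) \<Rightarrow> (nat \<Rightarrow> nat) \<Rightarrow> nat \<Rightarrow> nat \<Rightarrow> bool" where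
  "std_less \<tau> w i k \<longleftrightarrow> w i < w k \<or> w i = w k \<and> (if \<tau> (w i) then i < k else k < i)"

definition std_perm :: "(nat \<Rightarrow> bool) \<Rightarrow> nat \<Rightarrow> (nat \<Rightarrow> nat) \<Rightarrow> nat \<Rightarrow> nat" where
  "std_perm \<tau> n w i =
     (if i \<in> {1..n} then Suc (card {k \<in> {1..n}. std_less \<tau> w k i}) else i)"

lemma std_less_irrefl: "\<not> std_less \<tau> w i i"
  by (simp add: std_less_def)

lemma std_less_trans: "std_less \<tau> w i k \<Longrightarrow> std_less \<tau> w k l \<Longrightarrow> std_less \<tau> w i l"
  by (auto simp: std_less_def split: if_splits)

lemma std_less_linear: "i \<noteq> k \<Longrightarrow> std_less \<tau> w i k \<or> std_less \<tau> w k i"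
  by (auto simp: std_less_def)

lemma std_less_asym: "std_less \<tau> w i k \<Longrightarrow> \<not> std_less \<tau> w k i"
  using std_less_trans std_less_irrefl by blast

lemma std_perm_less_iff:
  assumes "i \<in> {1..n}" "k \<in> {1..n}"
  shows "std_perm \<tau> n w i < std_perm \<tau> n w k \<longleftrightarrow> std_less \<tau> w i k"
proof -
  have mono: "std_perm \<tau> n w i < std_perm \<tau> n w k"
    if "std_less \<tau> w i k" "i \<in> {1..n}" "k \<in> {1..n}" for i k
  proof -
    have "{l \<in> {1..n}. std_less \<tau> w l i} \<subset> {l \<in> {1..n}. std_less \<tau> w l k}"
      using that std_less_trans[of \<tau> w _ i k] std_less_irrefl[of \<tau> w i] by blast
    then have "card {l \<in> {1..n}. std_less \<tau> w l i} < card {l \<in> {1..n}. std_less \<tau> w l k}"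
      by (intro psubset_card_mono) auto
    then show ?thesis using that by (simp add: std_perm_def)
  qed
  show ?thesis
    using mono[of i k] mono[of k i] assms std_less_linear[of i k \<tau> w] by fastforce
qed

lemma std_perm_permutes: "std_perm \<tau> n w permutes {1..n}"
proof (rule bij_imp_permutes)
  have inj: "inj_on (std_perm \<tau> n w) {1..n}"
  proof (rule inj_onI)
    fix i k assume "i \<in> {1..n}" "k \<in> {1..n}" "std_perm \<tau> n w i = std_perm \<tau> n w k"
    then show "i = k"
      using std_perm_less_iff[of i n k \<tau> w] std_perm_less_iff[of k n i \<tau> w]
        std_less_linear[of i k \<tau> w] by auto
  qed
  moreover have "std_perm \<tau> n w i \<in> {1..n}" if "i \<in> {1..n}" for i
  proof -
    have "{k \<in> {1..n}. std_less \<tau> w k i} \<subset> {1..n}"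
      using that std_less_irrefl[of \<tau> w i] by blast
    then have "card {k \<in> {1..n}. std_less \<tau> w k i} < card {1..n}"
      by (intro psubset_card_mono) auto
    then show ?thesis using that by (simp add: std_perm_def)
  qed
  ultimately show "bij_betw (std_perm \<tau> n w) {1..n} {1..n}"
    unfolding bij_betw_def by (intro conjI endo_inj_surj) auto
qed (auto simp: std_perm_def)

lemma permutes_eq_rank:
  fixes \<pi> :: "nat \<Rightarrow> nat"
  assumes \<pi>: "\<pi> permutes {1..n}" and i: "i \<in> {1..n}"
  shows "\<pi> i = Suc (card {k \<in> {1..n}. \<pi> k < \<pi> i})"
proof -
  have "\<pi> ` {k \<in> {1..n}. \<pi> k < \<pi> i} = {1..<\<pi> i}"
  proof (intro equalityI subsetI)
    fix l assume l: "l \<in> {1..<\<pi> i}"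
    moreover have "\<pi> i \<in> {1..n}" using permutes_in_image[OF \<pi>] i by simp
    ultimately have "l \<in> {1..n}" by auto
    then have "inv \<pi> l \<in> {1..n}" "\<pi> (inv \<pi> l) = l"
      using permutes_in_image[OF permutes_inv[OF \<pi>]] permutes_inverses(1)[OF \<pi>] by auto
    then show "l \<in> \<pi> ` {k \<in> {1..n}. \<pi> k < \<pi> i}"
      using l by (intro image_eqI[of _ _ "inv \<pi> l"]) auto
  qed (use permutes_in_image[OF \<pi>] in force)
  then have "card {k \<in> {1..n}. \<pi> k < \<pi> i} = \<pi> i - 1"
    using card_image[OF inj_on_subset[OF permutes_inj[OF \<pi>]], of "{k \<in> {1..n}. \<pi> k < \<pi> i}"] by simp
  moreover have "\<pi> i \<ge> 1" using permutes_in_image[OF \<pi>, of i] i by simp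
  ultimately show ?thesis by simp
qed

text \<open>A permutation is recovered from the relative order of its values. One implication
  suffices: the converse follows from asymmetry of \<open>std_less\<close> and injectivity of
  \<pi>.\<close>

lemma std_perm_eqI:
  assumes \<pi>: "\<pi> permutes {1..n}"
    and less: "\<And>i k. i \<in> {1..n} \<Longrightarrow> k \<in> {1..n} \<Longrightarrow> \<pi> i < \<pi> k \<Longrightarrow> std_less \<tau> w i k"
  shows "std_perm \<tau> n w = \<pi>"
proof
  fix i
  show "std_perm \<tau> n w i = \<pi> i"
  proof (cases "i \<in> {1..n}")
    case True
    have "\<pi> k < \<pi> i \<longleftrightarrow> std_less \<tau> w k i" if "k \<in> {1..n}" for k
    proof (cases "k = i")
      case False
      then have "\<pi> k \<noteq> \<pi> i"
        using permutes_inj[OF \<pi>] by (auto dest: injD)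
      then show ?thesis
        using less[of k i] less[of i k] that True std_less_asym[of \<tau> w] by force
    qed (simp add: std_less_irrefl)
    then show ?thesis
      using permutes_eq_rank[OF \<pi> True] True by (simp add: std_perm_def cong: conj_cong)
  qed (use permutes_not_in[OF \<pi>] in \<open>auto simp: std_perm_def\<close>)
qed

text \<open>In the filling \<open>g\<close> equal letters form a block of consecutive positions, and
  all steps of \<open>inv \<pi>\<close> inside it go up for an unbarred and down for a barred
  letter. This is the tie-breaking rule of \<open>std_less\<close> for the word
  \<open>w\<close>.\<close>

lemma filling_std_less:
  assumes \<pi>: "\<pi> permutes {1..n}"
    and g: "g \<in> rel_chains n {..<b} (\<lambda>i. letter_rel \<tau> (inv \<pi> i < inv \<pi> (Suc i)))"
    and w: "\<And>i. i \<in> {1..n} \<Longrightarrow> w i = g (\<pi> i)"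
    and i: "i \<in> {1..n}" and k: "k \<in> {1..n}" and less: "\<pi> i < \<pi> k"
  shows "std_less \<tau> w i k"
proof -
  have rel: "letter_rel \<tau> (inv \<pi> i < inv \<pi> (Suc i)) (g i) (g (Suc i))" if "i \<in> {1..<n}" for i
    using g that by (auto simp: rel_chains_def)
  have inj: "inv \<pi> i = inv \<pi> k \<longleftrightarrow> i = k" for i k
    using permutes_inj[OF permutes_inv[OF \<pi>]] by (auto dest: injD)
  have *: "g a < g c \<or> g a = g c \<and> (if \<tau> (g a) then inv \<pi> a < inv \<pi> c else inv \<pi> c < inv \<pi> a)"
    if "a < c" "1 \<le> a" "c \<le> n" for a c
    using that
  proof (induction c)
    case (Suc c)
    have r: "letter_rel \<tau> (inv \<pi> c < inv \<pi> (Suc c)) (g c) (g (Suc c))"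
      using Suc.prems by (intro rel) auto
    have ne: "inv \<pi> c \<noteq> inv \<pi> (Suc c)" by (simp add: inj)
    show ?case
    proof (cases "a = c")
      case True
      then show ?thesis using r ne by (auto simp: letter_rel_def)
    next
      case False
      then show ?thesis using r ne Suc by (auto simp: letter_rel_def split: if_splits)
    qed
  qed simp
  have "\<pi> i \<in> {1..n}" "\<pi> k \<in> {1..n}"
    using permutes_in_image[OF \<pi>] i k by auto
  then show ?thesis
    using *[OF less] i k w permutes_inverses(2)[OF \<pi>] by (auto simp: std_less_def)
qed

text \<open>The letters of \<open>w\<close>, listed in the order \<open>std_less\<close> of their
  positions, increase weakly, and ties are broken exactly as \<open>letter_rel\<close> demands of
  the inverse.\<close>

lemma std_perm_filling:
  assumes "w \<in> {1..n} \<rightarrow>\<^sub>E {..<b}"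
  shows "restrict (w \<circ> inv (std_perm \<tau> n w)) {1..n} \<in>
    rel_chains n {..<b} (\<lambda>i. letter_rel \<tau> (inv (std_perm \<tau> n w) i < inv (std_perm \<tau> n w) (Suc i)))"
proof -
  let ?\<pi> = "std_perm \<tau> n w"
  have \<pi>: "?\<pi> permutes {1..n}" by (rule std_perm_permutes)
  have inv_in: "inv ?\<pi> i \<in> {1..n}" if "i \<in> {1..n}" for i
    using permutes_in_image[OF permutes_inv[OF \<pi>]] that by blast
  have "letter_rel \<tau> (inv ?\<pi> i < inv ?\<pi> (Suc i)) (w (inv ?\<pi> i)) (w (inv ?\<pi> (Suc i)))"
    if "i \<in> {1..<n}" for i
  proof -
    have "std_less \<tau> w (inv ?\<pi> i) (inv ?\<pi> (Suc i))"
      using that std_perm_less_iff[of "inv ?\<pi> i" n "inv ?\<pi> (Suc i)" \<tau> w] inv_in[of i] inv_in[of "Suc i"]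
        permutes_inverses(1)[OF \<pi>] by auto
    then show ?thesis
      by (auto simp: std_less_def letter_rel_def split: if_splits)
  qed
  then show ?thesis
    using inv_in assms by (auto simp: rel_chains_def PiE_iff)
qed

text \<open>Standardization is a bijection from all words over \<open>b\<close> letters to pairs of
  a permutation \<pi> and a filling \<open>g\<close> of its inverse; the word is \<open>g\<close>
  composed with \<pi>. The arbitrary factor \<Phi> leaves room for a second filling sum, or for 1
  when words are merely counted.\<close>

lemma standardization_sum:
  fixes v :: "nat \<Rightarrow> 'a::comm_ring_1"
  shows "(\<Sum>\<pi> | \<pi> permutes {1..n}. \<Phi> \<pi> * filling_sum \<tau> v b n (inv \<pi>)) =
         (\<Sum>w\<in>{1..n} \<rightarrow>\<^sub>E {..<b}. \<Phi> (std_perm \<tau> n w) * (\<Prod>i=1..n. v (w i)))"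
proof -
  let ?C = "\<lambda>\<pi>. rel_chains n {..<b} (\<lambda>i. letter_rel \<tau> (inv \<pi> i < inv \<pi> (Suc i)))"
  have std: "std_perm \<tau> n (restrict (g \<circ> \<pi>) {1..n}) = \<pi>" if "\<pi> permutes {1..n}" "g \<in> ?C \<pi>" for \<pi> g
    using that by (intro std_perm_eqI filling_std_less[of \<pi> n g b]) auto
  have inv_in: "inv \<pi> i \<in> {1..n}" if "\<pi> permutes {1..n}" "i \<in> {1..n}" for i \<pi>
    using permutes_in_image[OF permutes_inv[OF that(1)], of i] that(2) by simp
  have undo: "restrict (restrict (g \<circ> \<pi>) {1..n} \<circ> inv \<pi>) {1..n} = g"
    if "\<pi> permutes {1..n}" "g \<in> ?C \<pi>" for \<pi> g
  proof
    fix i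
    have "g \<in> extensional {1..n}" using that by (auto simp: rel_chains_def PiE_iff)
    then show "restrict (restrict (g \<circ> \<pi>) {1..n} \<circ> inv \<pi>) {1..n} i = g i"
      using inv_in[OF that(1)] permutes_inverses(1)[OF that(1)] by (auto simp: extensional_def restrict_def)
  qed
  have "(\<Sum>\<pi> | \<pi> permutes {1..n}. \<Phi> \<pi> * filling_sum \<tau> v b n (inv \<pi>)) =
        (\<Sum>(\<pi>, g)\<in>(SIGMA \<pi>:{\<pi>. \<pi> permutes {1..n}}. ?C \<pi>). \<Phi> \<pi> * (\<Prod>i=1..n. v (g i)))"
    unfolding filling_sum_def chain_sum_def sum_distrib_left
    by (subst sum.Sigma) (auto simp: finite_permutations finite_chains)
  also have "\<dots> = (\<Sum>w\<in>{1..n} \<rightarrow>\<^sub>E {..<b}. \<Phi> (std_perm \<tau> n w) * (\<Prod>i=1..n. v (w i)))"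
  proof (rule sum.reindex_bij_witness[where j = "\<lambda>(\<pi>, g). restrict (g \<circ> \<pi>) {1..n}"
      and i = "\<lambda>w. (std_perm \<tau> n w, restrict (w \<circ> inv (std_perm \<tau> n w)) {1..n})"], goal_cases)
    case (1 p)
    then obtain \<pi> g where "p = (\<pi>, g)" "\<pi> permutes {1..n}" "g \<in> ?C \<pi>" by auto
    then show ?case using std undo by simp
  next
    case (2 p)
    then obtain \<pi> g where p: "p = (\<pi>, g)" "\<pi> permutes {1..n}" "g \<in> ?C \<pi>" by auto
    have "g \<in> {1..n} \<rightarrow>\<^sub>E {..<b}" using p(3) by (simp add: rel_chains_def)
    then show ?case using p(1) permutes_in_image[OF p(2)] by (auto simp: PiE_iff)
  next
    case (3 w)
    let ?\<pi> = "std_perm \<tau> n w"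
    have "w i = undefined" if "i \<notin> {1..n}" for i
      using 3 that by (auto simp: PiE_iff extensional_def)
    then show ?case
      using permutes_in_image[OF std_perm_permutes[of \<tau> n w]]
        permutes_inverses(2)[OF std_perm_permutes[of \<tau> n w]]
      by (auto simp: fun_eq_iff restrict_def)
  next
    case (4 w)
    then show ?case using std_perm_permutes std_perm_filling by auto
  next
    case (5 p)
    then obtain \<pi> g where p: "p = (\<pi>, g)" "\<pi> permutes {1..n}" "g \<in> ?C \<pi>" by auto
    have "(\<Prod>i=1..n. v (g i)) = (\<Prod>i=1..n. v (g (\<pi> i)))"
      using prod.permute[OF p(2), of "\<lambda>i. v (g i)"] by (simp add: o_def)
    then show ?case
      using std[OF p(2,3)] p(1) by simp
  qed
  finally show ?thesis .
qed

text \<open>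
  The pairs \<open>(f i, g (\<pi> i))\<close>, read in the order of \<open>i\<close>, form a chain in the product alphabet, and
  standardization recovers \<open>\<pi>\<close>, \<open>f\<close> and \<open>g\<close> from that chain.
\<close>

lemma super_cauchy:
  fixes u v :: "nat \<Rightarrow> 'a::comm_ring_1"
  shows "(\<Sum>\<pi> | \<pi> permutes {1..n}. filling_sum \<sigma> u a n \<pi> * filling_sum \<tau> v b n (inv \<pi>)) =
    chain_sum n ({..<a} \<times> {..<b})
      (\<lambda>_ (k, l) (k', l'). letter_rel \<sigma> (l < l' \<or> l = l' \<and> \<tau> l) k k') (\<lambda>(k, l). u k * v l)"
proof -
  let ?T = "\<lambda>(k, l) (k', l'). letter_rel \<sigma> (l < l' \<or> l = l' \<and> \<tau> l) k k'"
  let ?r = "\<lambda>w i. letter_rel \<sigma> (w i < w (Suc i) \<or> w i = w (Suc i) \<and> \<tau> (w i))"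
  \<comment> \<open>An ascent of the standardization between neighbouring positions is visible from
    the two letters of \<open>w\<close>, so the permutation disappears from the relation.\<close>
  have fill: "filling_sum \<sigma> u a n (std_perm \<tau> n w) = chain_sum n {..<a} (?r w) u" for w
    unfolding filling_sum_def
    by (rule chain_sum_cong) (simp add: std_perm_less_iff std_less_def)
  have "(\<Sum>\<pi> | \<pi> permutes {1..n}. filling_sum \<sigma> u a n \<pi> * filling_sum \<tau> v b n (inv \<pi>)) =
        (\<Sum>w\<in>{1..n} \<rightarrow>\<^sub>E {..<b}. chain_sum n {..<a} (?r w) u * (\<Prod>i=1..n. v (w i)))"
    by (simp only: standardization_sum fill)
  also have "\<dots> = (\<Sum>(w, f)\<in>(SIGMA w:{1..n} \<rightarrow>\<^sub>E {..<b}. rel_chains n {..<a} (?r w)).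
        (\<Prod>i=1..n. u (f i)) * (\<Prod>i=1..n. v (w i)))"
    unfolding chain_sum_def sum_distrib_right
    by (subst sum.Sigma) (auto simp: finite_chains finite_PiE)
  also have "\<dots> = chain_sum n ({..<a} \<times> {..<b}) (\<lambda>_. ?T) (\<lambda>(k, l). u k * v l)"
    unfolding chain_sum_def
  proof (rule sum.reindex_bij_witness[where j = "\<lambda>(w, f). restrict (\<lambda>i. (f i, w i)) {1..n}"
      and i = "\<lambda>z. (restrict (snd \<circ> z) {1..n}, restrict (fst \<circ> z) {1..n})"], goal_cases)
    case (1 p)
    then show ?case by (auto simp: rel_chains_def PiE_iff extensional_def fun_eq_iff)
  next
    case (2 p)
    then show ?case by (auto simp: rel_chains_def PiE_iff)
  next
    case (3 z)
    then show ?case by (auto simp: rel_chains_def PiE_iff extensional_def fun_eq_iff)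
  next
    case (4 z)
    then show ?case by (auto simp: rel_chains_def PiE_iff case_prod_beta mem_Times_iff)
  next
    case (5 p)
    then show ?case by (auto simp: prod.distrib)
  qed
  finally show ?thesis .
qed

section \<open>Generating functions over the size of the alphabet\<close>

text \<open>Sums over the fillings of the first \<open>k + 1\<close> positions with last letter \<open>m\<close>.\<close>

primrec ending_sum ::
    "(nat \<Rightarrow> bool) \<Rightarrow> (nat \<Rightarrow> 'a) \<Rightarrow> (nat \<Rightarrow> nat) \<Rightarrow> nat \<Rightarrow> nat \<Rightarrow> 'a::comm_ring_1" where
  "ending_sum \<sigma> w \<pi> 0 m = w m"
| "ending_sum \<sigma> w \<pi> (Suc k) m = w m * ((\<Sum>l<m. ending_sum \<sigma> w \<pi> k l) +
     (if \<sigma> m = (\<pi> (Suc k) < \<pi> (Suc (Suc k))) then ending_sum \<sigma> w \<pi> k m else 0))"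

text \<open>Letters increase weakly, so all earlier letters are at most \<open>m\<close> and the
  size \<open>a\<close> of the alphabet drops out. The generating function over \<open>a\<close>
  then comes from partial sums over \<open>m\<close>.\<close>

lemma chain_end_letter_rel:
  "m < a \<Longrightarrow> chain_end k {..<a} (\<lambda>i. letter_rel \<sigma> (\<pi> i < \<pi> (Suc i))) w m = ending_sum \<sigma> w \<pi> k m"
proof (induction k arbitrary: m)
  case 0
  then show ?case by (simp add: chain_end_0)
next
  case (Suc k)
  let ?b = "\<pi> (Suc k) < \<pi> (Suc (Suc k))"
  have "{l. l \<in> {..<a} \<and> letter_rel \<sigma> ?b l m} = (if \<sigma> m = ?b then insert m {..<m} else {..<m})"
    using Suc.prems by (auto simp: letter_rel_def)
  moreover have "chain_end k {..<a} (\<lambda>i. letter_rel \<sigma> (\<pi> i < \<pi> (Suc i))) w l = ending_sum \<sigma> w \<pi> k l"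
    if "l \<le> m" for l
    using that Suc by simp
  ultimately show ?case
    by (simp add: chain_end_Suc add.commute)
qed

lemma filling_sum_Suc: "filling_sum \<sigma> w a (Suc k) \<pi> = (\<Sum>m<a. ending_sum \<sigma> w \<pi> k m)"
  by (simp add: filling_sum_def chain_sum_Suc chain_end_letter_rel)

section \<open>Recurrences in the last letter for the three alphabets\<close>

lemma fps_partial_sums:
  "Abs_fps (\<lambda>a. \<Sum>m<a. u m) * (1 - fps_X) = fps_X * (Abs_fps u :: 'a::comm_ring_1 fps)"
proof (rule fps_ext)
  fix n show "(Abs_fps (\<lambda>a. \<Sum>m<a. u m) * (1 - fps_X)) $ n = (fps_X * Abs_fps u) $ n"
    by (cases n) (simp_all add: right_diff_distrib fps_mult_fps_X_commute[symmetric])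
qed

lemma fps_geometric: "Abs_fps (\<lambda>_. 1) * (1 - fps_X) = (1 :: 'a::comm_ring_1 fps)"
proof (rule fps_ext)
  fix n show "(Abs_fps (\<lambda>_. 1) * (1 - fps_X) :: 'a fps) $ n = 1 $ n"
    by (cases n) (simp_all add: right_diff_distrib fps_mult_fps_X_commute[symmetric])
qed

text \<open>Multiplication by 1 - X takes differences in the last letter \<open>m\<close>. Of the
  shorter fillings only those ending in \<open>m\<close> survive at an ascent, and only those ending
  in \<open>m - 1\<close> at a descent.\<close>

lemma unsigned_ending_gf_Suc:
  fixes \<pi> :: "nat \<Rightarrow> nat"
  defines "U \<equiv> \<lambda>k. Abs_fps (ending_sum (\<lambda>_. True) (\<lambda>_. 1) \<pi> k) :: 'a::comm_ring_1 fps"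
  shows "U (Suc k) * (1 - fps_X) = (if \<pi> (Suc k) < \<pi> (Suc (Suc k)) then 1 else fps_X) * U k"
proof (rule fps_ext)
  fix n show "(U (Suc k) * (1 - fps_X)) $ n = ((if \<pi> (Suc k) < \<pi> (Suc (Suc k)) then 1 else fps_X) * U k) $ n"
    by (cases n) (simp_all add: U_def right_diff_distrib fps_mult_fps_X_commute[symmetric])
qed

abbreviation updown_ending :: "(nat \<Rightarrow> nat) \<Rightarrow> nat \<Rightarrow> nat \<Rightarrow> 'a::comm_ring_1" where
  "updown_ending \<equiv> ending_sum even (\<lambda>_. 1)"

text \<open>At an ascent the even letter \<open>m\<close> may be repeated and the odd letter
  \<open>m + 1\<close> may not, so for both the preceding letter runs through 0, ...,
  \<open>m\<close>. At \<open>k = 0\<close> both values are 1.\<close>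

lemma updown_ending_asc:
  assumes "k = 0 \<or> \<pi> k < \<pi> (Suc k)" "even m"
  shows "updown_ending \<pi> k (Suc m) = updown_ending \<pi> k m"
  using assms by (cases k) auto

text \<open>Now the odd letter is repeatable and the even one above it is not. The letter 0 is
  unbarred and has no admissible predecessor.\<close>

lemma updown_ending_desc:
  assumes "k \<noteq> 0" "\<not> \<pi> k < \<pi> (Suc k)"
  shows "odd m \<Longrightarrow> updown_ending \<pi> k (Suc m) = updown_ending \<pi> k m" "updown_ending \<pi> k 0 = 0"
  using assms by (cases k; auto)+

text \<open>
  The previous step fixes how consecutive coefficients of \<open>U k\<close> pair up, so one step multiplies
  \<open>U\<close> by a factor that only depends on whether the direction changes. The empty prefix counts as
  an ascent, which is the convention of \<^const>\<open>up_down_runs\<close>.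
\<close>

lemma updown_ending_gf_Suc:
  fixes \<pi> :: "nat \<Rightarrow> nat"
  defines "U \<equiv> \<lambda>k. Abs_fps (updown_ending \<pi> k) :: 'a::comm_ring_1 fps"
  shows "U (Suc k) * (1 - fps_X\<^sup>2) =
    (if (k = 0 \<or> \<pi> k < \<pi> (Suc k)) = (\<pi> (Suc k) < \<pi> (Suc (Suc k))) then 1 + fps_X\<^sup>2 else 2 * fps_X) * U k"
    (is "_ = ?c * _")
proof (rule fps_ext)
  fix n
  have L: "(U (Suc k) * (1 - fps_X\<^sup>2)) $ n = U (Suc k) $ n - (if n < 2 then 0 else U (Suc k) $ (n - 2))"
    by (simp add: right_diff_distrib fps_mult_fps_X_power_commute[symmetric] fps_X_power_mult_nth)
  have R1: "((1 + fps_X\<^sup>2) * U k) $ n = U k $ n + (if n < 2 then 0 else U k $ (n - 2))"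
    by (simp add: distrib_right fps_X_power_mult_nth)
  have R2: "(2 * fps_X * U k) $ n = 2 * (if n = 0 then 0 else U k $ (n - 1))"
    by (simp add: mult.assoc numeral_fps_const)
  \<comment> \<open>The parity of \<open>n\<close> decides how its coefficient is paired; 0 and 1
    are separate because the shift by 2 leaves the range.\<close>
  have n: "n = 0 \<or> n = 1 \<or> (\<exists>m. n = Suc (Suc (2 * m))) \<or> (\<exists>m. n = Suc (Suc (Suc (2 * m))))"
    by presburger
  show "(U (Suc k) * (1 - fps_X\<^sup>2)) $ n = (?c * U k) $ n"
  proof (cases "k = 0 \<or> \<pi> k < \<pi> (Suc k)")
    case True
    note asc = updown_ending_asc[OF True, where 'a = 'a]
    have "updown_ending \<pi> k (Suc 0) = (updown_ending \<pi> k 0 :: 'a)"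
      "updown_ending \<pi> k (Suc (2 * m)) = (updown_ending \<pi> k (2 * m) :: 'a)"
      "updown_ending \<pi> k (Suc (Suc (Suc (2 * m)))) = (updown_ending \<pi> k (Suc (Suc (2 * m))) :: 'a)" for m
      by (rule asc; simp)+
    then show ?thesis
      unfolding L if_distrib[of "\<lambda>c. (c * U k) $ n"] R1 R2 using n True
      by (elim disjE exE) (simp_all add: U_def)
  next
    case False
    then have desc: "k \<noteq> 0" "\<not> \<pi> k < \<pi> (Suc k)" by auto
    have "updown_ending \<pi> k (Suc (Suc (2 * m))) = (updown_ending \<pi> k (Suc (2 * m)) :: 'a)" for m
      by (rule updown_ending_desc[OF desc]) simp
    moreover have "updown_ending \<pi> k 0 = (0 :: 'a)"
      by (rule updown_ending_desc[OF desc])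
    ultimately show ?thesis
      unfolding L if_distrib[of "\<lambda>c. (c * U k) $ n"] R1 R2 using n False
      by (elim disjE exE) (simp_all add: U_def)
  qed
qed

text \<open>Pair number \<open>m\<close> consists of the barred letter \<open>2 * m\<close> of
  weight \<open>y\<close>, followed by the unbarred letter \<open>2 * m + 1\<close> of weight
  1.\<close>

abbreviation barred_ending :: "'a \<Rightarrow> (nat \<Rightarrow> nat) \<Rightarrow> nat \<Rightarrow> nat \<Rightarrow> 'a::comm_ring_1" where
  "barred_ending y \<equiv> ending_sum odd (\<lambda>m. if odd m then 1 else y)"

text \<open>At an ascent the barred letter \<open>2 * m\<close> is not repeatable while the unbarred
  letter just below it is, so both have the same predecessors. The factor X is the step to the
  previous pair.\<close>

lemma barred_ending_asc:
  fixes y :: "'a::comm_ring_1" and \<pi> :: "nat \<Rightarrow> nat"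
  assumes "k \<noteq> 0" "\<pi> k < \<pi> (Suc k)"
  shows "Abs_fps (\<lambda>m. barred_ending y \<pi> k (2 * m)) =
    fps_const y * fps_X * Abs_fps (\<lambda>m. barred_ending y \<pi> k (Suc (2 * m)))"
proof (rule fps_ext)
  fix n
  show "Abs_fps (\<lambda>m. barred_ending y \<pi> k (2 * m)) $ n =
    (fps_const y * fps_X * Abs_fps (\<lambda>m. barred_ending y \<pi> k (Suc (2 * m)))) $ n"
    using assms by (cases k; cases n) (auto simp: mult.assoc)
qed

text \<open>At a descent the barred letter is repeatable and its unbarred partner is not. The empty
  prefix goes with descents here, since a peak needs an ascent before it.\<close>

lemma barred_ending_desc:
  fixes y :: "'a::comm_ring_1" and \<pi> :: "nat \<Rightarrow> nat"
  assumes "k = 0 \<or> \<not> \<pi> k < \<pi> (Suc k)"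
  shows "Abs_fps (\<lambda>m. barred_ending y \<pi> k (2 * m)) =
    fps_const y * Abs_fps (\<lambda>m. barred_ending y \<pi> k (Suc (2 * m)))"
  using assms by (cases k) (auto simp: fps_eq_iff)

text \<open>Differences are taken between the unbarred letters of neighbouring pairs. The barred
  sums are already expressed through the unbarred ones, so this recurrence closes the
  system.\<close>

lemma barred_ending_gf_Suc:
  fixes y :: "'a::comm_ring_1" and \<pi> :: "nat \<Rightarrow> nat"
  defines "E \<equiv> \<lambda>k. Abs_fps (\<lambda>m. barred_ending y \<pi> k (2 * m))"
    and "O' \<equiv> \<lambda>k. Abs_fps (\<lambda>m. barred_ending y \<pi> k (Suc (2 * m)))"
  shows "O' (Suc k) * (1 - fps_X) = E k + (if \<pi> (Suc k) < \<pi> (Suc (Suc k)) then 1 else fps_X) * O' k"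
proof (rule fps_ext)
  fix n show "(O' (Suc k) * (1 - fps_X)) $ n =
      (E k + (if \<pi> (Suc k) < \<pi> (Suc (Suc k)) then 1 else fps_X) * O' k) $ n"
    by (cases n) (simp_all add: E_def O'_def right_diff_distrib fps_mult_fps_X_commute[symmetric])
qed

lemma barred_filling_gf:
  fixes y :: "'a::comm_ring_1" and \<pi> :: "nat \<Rightarrow> nat"
  shows "Abs_fps (\<lambda>j. \<Sum>m<2 * j. barred_ending y \<pi> k m) * (1 - fps_X) =
    fps_X * (Abs_fps (\<lambda>m. barred_ending y \<pi> k (2 * m)) +
             Abs_fps (\<lambda>m. barred_ending y \<pi> k (Suc (2 * m))))"
proof -
  have "(\<Sum>m<2 * j. barred_ending y \<pi> k m) =
      (\<Sum>m<j. barred_ending y \<pi> k (2 * m) + barred_ending y \<pi> k (Suc (2 * m)))" for j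
    by (induction j) (simp_all add: algebra_simps)
  then show ?thesis
    by (simp only: fps_partial_sums) (simp add: fps_eq_iff algebra_simps)
qed

section \<open>Recurrences for the statistics\<close>

lemma des_Suc: "des (Suc (Suc k)) \<pi> = des (Suc k) \<pi> + (if \<pi> (Suc k) > \<pi> (Suc (Suc k)) then 1 else 0)"
proof -
  have "{i. 1 \<le> i \<and> i < Suc (Suc k) \<and> \<pi> i > \<pi> (i + 1)} =
      {i. 1 \<le> i \<and> i < Suc k \<and> \<pi> i > \<pi> (i + 1)} \<union> (if \<pi> (Suc k) > \<pi> (Suc (Suc k)) then {Suc k} else {})"
    by (auto simp: less_Suc_eq)
  then show ?thesis
    unfolding des_def by (subst card_Un_disjoint[symmetric, OF _ _ ] | simp)+
qed

lemma des_1: "des (Suc 0) \<pi> = 0"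
  by (auto simp: des_def)

lemma pk_1: "pk (Suc 0) \<pi> = 0"
  by (auto simp: pk_def)

lemma pk_Suc: "pk (Suc (Suc k)) \<pi> = pk (Suc k) \<pi> +
    (if k \<noteq> 0 \<and> \<pi> k < \<pi> (Suc k) \<and> \<pi> (Suc k) > \<pi> (Suc (Suc k)) then 1 else 0)"
proof -
  have "{i. 2 \<le> i \<and> i < Suc (Suc k) \<and> \<pi> (i - 1) < \<pi> i \<and> \<pi> i > \<pi> (i + 1)} =
      {i. 2 \<le> i \<and> i < Suc k \<and> \<pi> (i - 1) < \<pi> i \<and> \<pi> i > \<pi> (i + 1)} \<union>
      (if k \<noteq> 0 \<and> \<pi> k < \<pi> (Suc k) \<and> \<pi> (Suc k) > \<pi> (Suc (Suc k)) then {Suc k} else {})"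
    by (auto simp: less_Suc_eq)
  then show ?thesis
    unfolding pk_def by (subst card_Un_disjoint[symmetric, OF _ _ ] | simp)+
qed

section \<open>Biruns and up-down runs through the directions of steps\<close>

lemma rel_of_Suc_steps:
  fixes \<pi> :: "nat \<Rightarrow> 'b"
  assumes "transp R" "\<And>i. a \<le> i \<Longrightarrow> i < b \<Longrightarrow> R (\<pi> i) (\<pi> (Suc i))"
  shows "i < k \<Longrightarrow> a \<le> i \<Longrightarrow> k \<le> b \<Longrightarrow> R (\<pi> i) (\<pi> k)"
proof (induction k)
  case (Suc k)
  then show ?case
    using assms(2)[of k] transpD[OF assms(1), of "\<pi> i" "\<pi> k" "\<pi> (Suc k)"] by (cases "i = k") auto
qed simp

text \<open>Injectivity makes every step a strict ascent or a strict descent, so monotonicity means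
  that all steps have one direction.\<close>

lemma mem_monotone_segments_iff:
  assumes "inj_on \<pi> {1..n}"
  shows "(a, b) \<in> monotone_segments n \<pi> \<longleftrightarrow> 1 \<le> a \<and> a \<le> b \<and> b \<le> n \<and>
    (\<forall>i k. a \<le> i \<and> i < b \<and> a \<le> k \<and> k < b \<longrightarrow> (\<pi> i < \<pi> (Suc i)) = (\<pi> k < \<pi> (Suc k)))"
    (is "_ \<longleftrightarrow> ?R")
proof
  assume "(a, b) \<in> monotone_segments n \<pi>"
  then have *: "1 \<le> a" "a \<le> b" "b \<le> n" "strict_mono_on {a..b} \<pi> \<or> strict_antimono_on {a..b} \<pi>"
    by (auto simp: monotone_segments_def)
  then have "(\<forall>i. a \<le> i \<and> i < b \<longrightarrow> \<pi> i < \<pi> (Suc i)) \<or> (\<forall>i. a \<le> i \<and> i < b \<longrightarrow> \<pi> i > \<pi> (Suc i))"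
    by (auto simp: monotone_on_def)
  then show ?R using * by (meson order.asym)
next
  assume R: ?R
  have ne: "\<pi> i \<noteq> \<pi> (Suc i)" if "a \<le> i" "i < b" for i
    using that R inj_onD[OF assms, of i "Suc i"] by auto
  have "(\<forall>i. a \<le> i \<and> i < b \<longrightarrow> \<pi> i < \<pi> (Suc i)) \<or> (\<forall>i. a \<le> i \<and> i < b \<longrightarrow> \<pi> i > \<pi> (Suc i))"
    using R ne by (metis linorder_neq_iff)
  then have "strict_mono_on {a..b} \<pi> \<or> strict_antimono_on {a..b} \<pi>"
  proof
    assume "\<forall>i. a \<le> i \<and> i < b \<longrightarrow> \<pi> i < \<pi> (Suc i)"
    then show ?thesis
      using rel_of_Suc_steps[of "(<)" a b \<pi>] by (auto simp: monotone_on_def)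
  next
    assume "\<forall>i. a \<le> i \<and> i < b \<longrightarrow> \<pi> i > \<pi> (Suc i)"
    then show ?thesis
      using rel_of_Suc_steps[of "(>)" a b \<pi>] by (auto simp: monotone_on_def)
  qed
  then show "(a, b) \<in> monotone_segments n \<pi>"
    using R by (simp add: monotone_segments_def)
qed

text \<open>A birun is determined by its left end \<open>Suc k\<close>, which is the first position
  or a turn. With \<open>n \<ge> 2\<close> every birun has at least two entries, so the last
  position is no left end.\<close>

lemma card_biruns:
  assumes inj: "inj_on \<pi> {1..n}" and n: "n \<ge> 2"
  shows "card (biruns n \<pi>) =
    card {k. Suc k < n \<and> (k = 0 \<or> (\<pi> k < \<pi> (Suc k)) \<noteq> (\<pi> (Suc k) < \<pi> (Suc (Suc k))))}"
proof -
  let ?M = "monotone_segments n \<pi>"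
  let ?asc = "\<lambda>i. \<pi> i < \<pi> (Suc i)"
  let ?S = "{k. Suc k < n \<and> (k = 0 \<or> ?asc k \<noteq> ?asc (Suc k))}"
  note seg = mem_monotone_segments_iff[OF inj]
  have birun_iff: "(a, b) \<in> biruns n \<pi> \<longleftrightarrow>
      (a, b) \<in> ?M \<and> (\<forall>c d. (c, d) \<in> ?M \<and> c \<le> a \<and> b \<le> d \<longrightarrow> c = a \<and> d = b)" for a b
  proof -
    have "(a, b) \<in> ?M \<Longrightarrow> a \<le> b" by (simp add: seg)
    then show ?thesis by (fastforce simp: biruns_def)
  qed
  \<comment> \<open>Two segments with the same left end are nested, so maximality makes them
    equal.\<close>
  have "inj_on (\<lambda>(a, b). a - 1) (biruns n \<pi>)"
  proof (rule inj_onI, clarify)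
    fix a b a' b' assume *: "(a, b) \<in> biruns n \<pi>" "(a', b') \<in> biruns n \<pi>" "a - 1 = a' - 1"
    then have "1 \<le> a" "1 \<le> a'" by (simp_all add: birun_iff seg)
    then have "a = a'" using *(3) by simp
    then show "a = a' \<and> b = b'"
      using * unfolding birun_iff by (metis nat_le_linear order_refl)
  qed
  moreover have "(\<lambda>(a, b). a - 1) ` biruns n \<pi> = ?S"
  proof (intro equalityI subsetI)
    fix k assume "k \<in> (\<lambda>(a, b). a - 1) ` biruns n \<pi>"
    then obtain a b where ab: "(a, b) \<in> biruns n \<pi>" "k = a - 1" by auto
    then have M: "(a, b) \<in> ?M" and max: "\<And>c d. (c, d) \<in> ?M \<Longrightarrow> c \<le> a \<Longrightarrow> b \<le> d \<Longrightarrow> c = a \<and> d = b"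
      by (auto simp: birun_iff)
    have bounds: "1 \<le> a" "a \<le> b" "b \<le> n" using M by (auto simp: seg)
    \<comment> \<open>A single entry extends by its right neighbour, or by its left neighbour at the
      end of the word.\<close>
    have "a \<noteq> b"
    proof
      assume eq: "a = b"
      show False
      proof (cases "a < n")
        case True
        then have "(a, Suc a) \<in> ?M" using bounds by (auto simp: seg less_Suc_eq_le)
        then show False using max[of a "Suc a"] eq by simp
      next
        case False
        then have a: "a = Suc (a - 1)" "1 \<le> a - 1" using bounds n by auto
        have "i = a - 1" if "a - 1 \<le> i" "i < a" for i using that by simp
        then have "(a - 1, a) \<in> ?M" using a bounds eq unfolding seg by (metis diff_le_self)
        then show False using max[of "a - 1" a] eq bounds by simp
      qed
    qed
    \<comment> \<open>Without a turn the segment would extend to the left.\<close>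
    moreover have "?asc k \<noteq> ?asc (Suc k)" if "k \<noteq> 0"
    proof
      assume eq: "?asc k = ?asc (Suc k)"
      have a: "a = Suc k" using ab(2) that by simp
      have "?asc i = ?asc a" if "k \<le> i" "i < b" for i
        using that eq M \<open>a \<noteq> b\<close> bounds unfolding a seg by (cases "i = k") auto
      then have "(k, b) \<in> ?M" using bounds \<open>k \<noteq> 0\<close> a by (simp add: seg)
      then show False using max[of k b] a by simp
    qed
    ultimately show "k \<in> ?S" using ab(2) bounds by auto
  next
    fix k assume k: "k \<in> ?S"
    let ?B = "{b. (Suc k, b) \<in> ?M}"
    \<comment> \<open>The longest segment starting at \<open>Suc k\<close>; the turn at
      \<open>k\<close> prevents an extension to the left.\<close>
    define b where "b = Max ?B"
    have fin: "finite ?B" by (rule finite_subset[of _ "{..n}"]) (auto simp: seg)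
    have "Suc (Suc k) \<in> ?B" using k by (auto simp: seg less_Suc_eq_le)
    then have "b \<in> ?B" and b: "Suc (Suc k) \<le> b"
      unfolding b_def using fin Max_in[OF fin] Max_ge[OF fin] by blast+
    moreover have "c = Suc k \<and> d = b" if cd: "(c, d) \<in> ?M" "c \<le> Suc k" "b \<le> d" for c d
    proof -
      have "c = Suc k"
      proof (rule ccontr)
        assume "c \<noteq> Suc k"
        then have "c \<le> k" "k < d" "Suc k < d" using cd b by auto
        moreover have "1 \<le> c" using cd(1) by (simp add: seg)
        ultimately have "?asc k = ?asc (Suc k)" "k \<noteq> 0" using cd(1) unfolding seg by auto
        then show False using k by auto
      qed
      moreover from this have "d \<le> b" unfolding b_def using cd(1) fin by (intro Max_ge) auto
      ultimately show ?thesis using cd(3) by simp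
    qed
    ultimately have "(Suc k, b) \<in> biruns n \<pi>" unfolding birun_iff by blast
    then show "k \<in> (\<lambda>(a, b). a - 1) ` biruns n \<pi>" by force
  qed
  ultimately show ?thesis using card_image by metis
qed

lemma finite_biruns: "finite (biruns n \<pi>)"
  by (rule finite_subset[of _ "{..n} \<times> {..n}"]) (auto simp: biruns_def monotone_segments_def)

lemma udr_1: "udr (Suc 0) \<pi> = 1"
proof -
  have "monotone_segments (Suc 0) \<pi> = {(1, 1)}"
    by (auto simp: monotone_segments_def monotone_on_def)
  then have "biruns (Suc 0) \<pi> = {(1, 1)}" by (auto simp: biruns_def)
  then show ?thesis by (simp add: udr_def up_down_runs_def)
qed

text \<open>The successor accounts for the birun that starts at position 1. Letting the empty prefix
  count as an ascent makes the extra run of an initial descent a turn at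
  \<open>k = 0\<close>.\<close>

lemma udr_eq_turns:
  assumes inj: "inj_on \<pi> {1..Suc n}"
  shows "udr (Suc n) \<pi> =
    Suc (card {k. k < n \<and> (k = 0 \<or> \<pi> k < \<pi> (Suc k)) \<noteq> (\<pi> (Suc k) < \<pi> (Suc (Suc k)))})"
proof (cases n)
  case 0
  then show ?thesis by (simp add: udr_1)
next
  case (Suc m)
  let ?turn = "\<lambda>k. (\<pi> k < \<pi> (Suc k)) \<noteq> (\<pi> (Suc k) < \<pi> (Suc (Suc k)))"
  let ?T = "{k. 0 < k \<and> k < n \<and> ?turn k}"
  have fin: "finite ?T" by simp
  have "\<pi> 1 \<noteq> \<pi> 2" using inj_onD[OF inj, of 1 2] Suc by auto
  then have "{k. k < n \<and> (k = 0 \<or> \<pi> k < \<pi> (Suc k)) \<noteq> (\<pi> (Suc k) < \<pi> (Suc (Suc k)))} =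
      (if \<pi> 1 > \<pi> 2 then insert 0 ?T else ?T)"
    using Suc by (auto simp: numeral_2_eq_2 intro: gr0I)
  moreover have "{k. Suc k < Suc n \<and> (k = 0 \<or> ?turn k)} = insert 0 ?T"
    using Suc by auto
  \<comment> \<open>The added run is a new element of the union, since \<open>(1, 1)\<close> is
    properly contained in the segment \<open>(1, 2)\<close>.\<close>
  moreover have "(1, 1) \<notin> biruns (Suc n) \<pi>"
  proof -
    have "(1, 2) \<in> monotone_segments (Suc n) \<pi>"
      unfolding mem_monotone_segments_iff[OF inj] using Suc by (auto simp: less_Suc_eq numeral_2_eq_2)
    moreover have "{1..1} \<subseteq> {1..2::nat}" by auto
    ultimately show ?thesis unfolding biruns_def by fastforce
  qed
  ultimately show ?thesis
    using card_biruns[OF inj] Suc fin finite_biruns[of "Suc n" \<pi>]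
    by (simp add: udr_def up_down_runs_def)
qed

lemma udr_Suc:
  assumes "inj_on \<pi> {1..Suc (Suc k)}"
  shows "udr (Suc (Suc k)) \<pi> = udr (Suc k) \<pi> +
    (if (k = 0 \<or> \<pi> k < \<pi> (Suc k)) = (\<pi> (Suc k) < \<pi> (Suc (Suc k))) then 0 else 1)"
proof -
  have "inj_on \<pi> {1..Suc k}" by (rule inj_on_subset[OF assms]) auto
  moreover have "{l. l < Suc k \<and> (l = 0 \<or> \<pi> l < \<pi> (Suc l)) \<noteq> (\<pi> (Suc l) < \<pi> (Suc (Suc l)))} =
      {l. l < k \<and> (l = 0 \<or> \<pi> l < \<pi> (Suc l)) \<noteq> (\<pi> (Suc l) < \<pi> (Suc (Suc l)))} \<union>
      (if (k = 0 \<or> \<pi> k < \<pi> (Suc k)) = (\<pi> (Suc k) < \<pi> (Suc (Suc k))) then {} else {k})"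
    by (auto simp: less_Suc_eq)
  ultimately show ?thesis
    using udr_eq_turns[OF assms] udr_eq_turns[of \<pi> k] by (simp add: card_Un_disjoint)
qed

section \<open>Eulerian polynomials and the product formula\<close>

lemma unsigned_ending_gf:
  fixes \<pi> :: "nat \<Rightarrow> nat"
  assumes "inj_on \<pi> {1..Suc k}"
  shows "Abs_fps (ending_sum (\<lambda>_. True) (\<lambda>_. 1) \<pi> k) * (1 - fps_X) ^ Suc k =
    (fps_X ^ des (Suc k) \<pi> :: 'a::comm_ring_1 fps)"
  using assms
proof (induction k)
  case 0
  then show ?case by (simp add: des_1 fps_geometric)
next
  case (Suc k)
  have inj: "inj_on \<pi> {1..Suc k}" using Suc.prems by (rule inj_on_subset) auto
  have ne: "\<pi> (Suc k) \<noteq> \<pi> (Suc (Suc k))" using inj_onD[OF Suc.prems, of "Suc k" "Suc (Suc k)"] by auto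
  have "Abs_fps (ending_sum (\<lambda>_. True) (\<lambda>_. 1) \<pi> (Suc k)) * (1 - fps_X) ^ Suc (Suc k) =
      (if \<pi> (Suc k) < \<pi> (Suc (Suc k)) then 1 else fps_X) *
      (Abs_fps (ending_sum (\<lambda>_. True) (\<lambda>_. 1) \<pi> k) * (1 - fps_X) ^ Suc k :: 'a fps)"
    by (simp only: power_Suc[of _ "Suc k"] mult.assoc[symmetric] unsigned_ending_gf_Suc)
  also have "\<dots> = fps_X ^ des (Suc (Suc k)) \<pi>"
    unfolding Suc.IH[OF inj] des_Suc using ne by (auto simp: not_less_iff_gr_or_eq)
  finally show ?case .
qed

text \<open>Summing the fillings of all permutations with \<open>j\<close> unbarred letters counts
  all \<open>j ^ n\<close> words, by standardization, while each permutation contributes X^(des + 1)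
  / (1 - X)^(n + 1). For \<open>n = 0\<close> the convention 0^0 = 1 matches A_0 = 1.\<close>

lemma eulerian_A_gf:
  "eulerian_A n (fps_X :: 'a::comm_ring_1 fps) = Abs_fps (\<lambda>j. of_nat j ^ n) * (1 - fps_X) ^ (n + 1)"
proof (cases n)
  case 0
  then show ?thesis by (simp add: eulerian_A_def fps_geometric)
next
  case (Suc k)
  let ?F = "\<lambda>j \<pi>. filling_sum (\<lambda>_. True) (\<lambda>_. 1) j n \<pi> :: 'a"
  have one: "Abs_fps (\<lambda>j. ?F j \<pi>) * (1 - fps_X) ^ (n + 1) = fps_X ^ (des n \<pi> + 1)"
    if "\<pi> permutes {1..n}" for \<pi>
  proof -
    have "inj_on \<pi> {1..Suc k}" using permutes_inj_on[OF that] by simp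
    from unsigned_ending_gf[OF this, where 'a = 'a] show ?thesis
      by (simp add: Suc filling_sum_Suc mult.assoc[symmetric] fps_partial_sums)
        (simp add: mult.assoc)
  qed
  have "(\<Sum>\<pi> | \<pi> permutes {1..n}. ?F j \<pi>) = of_nat j ^ n" for j
  proof -
    have "(\<Sum>\<pi> | \<pi> permutes {1..n}. ?F j \<pi>) = (\<Sum>\<pi> | \<pi> permutes {1..n}. 1 * ?F j (inv \<pi>))"
      by (subst sum_permutations_inverse) simp
    also have "\<dots> = (\<Sum>w\<in>{1..n} \<rightarrow>\<^sub>E {..<j}. 1)"
      by (subst standardization_sum) simp
    also have "\<dots> = of_nat j ^ n"
      by (simp add: card_PiE)
    finally show ?thesis .
  qed
  then have "Abs_fps (\<lambda>j. of_nat j ^ n) = (\<Sum>\<pi> | \<pi> permutes {1..n}. Abs_fps (\<lambda>j. ?F j \<pi>))"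
    by (simp add: fps_eq_iff fps_sum_nth)
  then have "Abs_fps (\<lambda>j. of_nat j ^ n) * (1 - fps_X) ^ (n + 1) =
      (\<Sum>\<pi> | \<pi> permutes {1..n}. fps_X ^ (des n \<pi> + 1) :: 'a fps)"
    by (simp only: sum_distrib_right) (rule sum.cong, simp_all only: mem_Collect_eq one)
  then show ?thesis
    using Suc by (simp add: eulerian_A_def)
qed

lemma prod_lessThan_double:
  "(\<Prod>l<2 * j. g l) = (\<Prod>m<j. g (2 * m) * g (Suc (2 * m)) :: 'a::comm_monoid_mult)"
  by (induction j) (simp_all add: ac_simps)

text \<open>Up to repetitions the relation on pairs is a linear order: rows follow the first letter,
  and an unbarred row is read upwards, a barred one downwards, because a barred letter may be
  repeated only along a descent. A pair is repeatable exactly when its two signs agree.\<close>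

lemma super_cauchy_gf:
  fixes u v :: "nat \<Rightarrow> 'a::field"
  shows "Abs_fps (\<lambda>n. \<Sum>\<pi> | \<pi> permutes {1..n}. filling_sum \<sigma> u a n \<pi> * filling_sum \<tau> v b n (inv \<pi>)) =
    (\<Prod>k<a. \<Prod>l<b. if \<sigma> k = \<tau> l then inverse (1 - fps_const (u k * v l) * fps_X)
                     else 1 + fps_const (u k * v l) * fps_X)"
proof -
  let ?S = "{..<a} \<times> {..<b}"
  let ?T = "\<lambda>(k, l) (k', l'). letter_rel \<sigma> (l < l' \<or> l = l' \<and> \<tau> l) k k'"
  define row where "row k l = (if \<sigma> k then l else b - Suc l)" for k l
  \<comment> \<open>The rank of a pair in this order, with \<open>b\<close> places for each
    row.\<close>
  define key where "key = (\<lambda>(k, l). k * b + row k l)"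
  have row: "row k l < b" if "l < b" for k l using that by (auto simp: row_def)
  have key_div: "key (k, l) div b = k" and key_mod: "key (k, l) mod b = row k l" if "l < b" for k l
    using row[OF that, of k] by (simp_all add: key_def)
  have key_less: "key (k, l) < key (k', l')" if "k < k'" "l < b" "l' < b" for k l k' l'
  proof (rule ccontr)
    assume "\<not> key (k, l) < key (k', l')"
    then have "key (k', l') div b \<le> key (k, l) div b" by (intro div_le_mono) simp
    then show False using that by (simp add: key_div)
  qed
  have T: "?T z z' \<longleftrightarrow> key z < key z' \<or> z = z' \<and> (case z of (k, l) \<Rightarrow> \<sigma> k = \<tau> l)"
    if zz: "z \<in> ?S" "z' \<in> ?S" for z z'
  proof -
    obtain k l k' l' where z: "z = (k, l)" "z' = (k', l')" by (cases z, cases z')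
    with zz have l: "l < b" "l' < b" by auto
    consider "k < k'" | "k' < k" | "k = k'" by linarith
    then show ?thesis
    proof cases
      case 3
      show ?thesis
        using l by (cases l l' rule: linorder_cases) (auto simp: z 3 letter_rel_def key_def row_def)
    qed (use key_less[of k k' l l'] key_less[of k' k l' l] l in \<open>auto simp: z letter_rel_def\<close>)
  qed
  have inj: "inj_on key ?S"
  proof (rule inj_onI)
    fix z z' assume *: "z \<in> ?S" "z' \<in> ?S" "key z = key z'"
    obtain k l k' l' where z: "z = (k, l)" "z' = (k', l')" by (cases z, cases z')
    with * have l: "l < b" "l' < b" by auto
    with * have "k = k'" using key_div z by metis
    then show "z = z'" using * l z by (auto simp: key_def row_def split: if_splits)
  qed
  have "Abs_fps (\<lambda>n. chain_sum n ?S (\<lambda>_. ?T) (\<lambda>(k, l). u k * v l)) =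
    (\<Prod>z\<in>?S. if (case z of (k, l) \<Rightarrow> \<sigma> k = \<tau> l) then inverse (1 - fps_const ((\<lambda>(k, l). u k * v l) z) * fps_X)
       else 1 + fps_const ((\<lambda>(k, l). u k * v l) z) * fps_X)"
    by (rule chain_sum_gf[OF _ inj T]) auto
  then show ?thesis
    unfolding super_cauchy prod.cartesian_product by (rule trans) (auto intro!: prod.cong)
qed

text \<open>A row with unbarred first letter contributes \<open>R ^ j\<close> and one with barred
  first letter \<open>Q ^ j\<close>. The \<open>a\<close> rows alternate, starting with an unbarred
  one, so an odd \<open>a\<close> leaves one extra \<open>R ^ j\<close>.\<close>

lemma updown_barred_gf:
  fixes y :: "'a::field"
  shows "Abs_fps (\<lambda>n. \<Sum>\<pi> | \<pi> permutes {1..n}.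
        filling_sum even (\<lambda>_. 1) a n \<pi> * filling_sum odd (\<lambda>m. if odd m then 1 else y) (2 * j) n (inv \<pi>)) =
    ((1 + fps_X) * (1 + fps_const y * fps_X) * inverse (1 - fps_const y * fps_X) * inverse (1 - fps_X)) ^ (a div 2 * j)
     * (if odd a then ((1 + fps_const y * fps_X) * inverse (1 - fps_X)) ^ j else 1)"
proof -
  define R where "R = (1 + fps_const y * fps_X) * inverse (1 - fps_X :: 'a fps)"
  define Q where "Q = (1 + fps_X) * inverse (1 - fps_const y * fps_X :: 'a fps)"
  let ?f = "\<lambda>k l. if even k = odd l then inverse (1 - fps_const (1 * (if odd l then 1 else y)) * fps_X)
                     else 1 + fps_const (1 * (if odd l then 1 else y)) * fps_X"
  have row: "(\<Prod>l<2 * j. ?f k l) = (if even k then R ^ j else Q ^ j)" for k :: nat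
    unfolding prod_lessThan_double by (simp add: R_def Q_def mult.commute)
  have "(\<Prod>k<a. if even k then R ^ j else Q ^ j) = (Q * R) ^ (a div 2 * j) * (if odd a then R ^ j else 1)"
  proof -
    have "(\<Prod>k<2 * i. if even k then R ^ j else Q ^ j) = (Q * R) ^ (i * j)" for i
      unfolding prod_lessThan_double
      by (simp add: power_mult_distrib[symmetric] power_mult[symmetric] mult.commute)
    note * = this
    show ?thesis
    proof (cases "odd a")
      case True
      then obtain i where "a = Suc (2 * i)" by (auto elim: oddE)
      then show ?thesis using *[of i] by simp
    next
      case False
      then obtain i where "a = 2 * i" by (auto elim: evenE)
      then show ?thesis using *[of i] by simp
    qed
  qed
  moreover have "(1 + fps_X) * (1 + fps_const y * fps_X) * inverse (1 - fps_const y * fps_X) *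
      inverse (1 - fps_X) = Q * R"
    by (simp add: Q_def R_def mult_ac)
  ultimately show ?thesis
    unfolding super_cauchy_gf row by (simp only: R_def[symmetric])
qed

section \<open>The exponential formula for partitions\<close>

lemma sum_mset_eq_sum_count:
  "finite A \<Longrightarrow> set_mset M \<subseteq> A \<Longrightarrow> sum_mset M = (\<Sum>k\<in>A. k * count M k)" for M :: "nat multiset"
proof (induction M)
  case (add x M)
  then have "(\<Sum>k\<in>A. k * count (add_mset x M) k) = (\<Sum>k\<in>A. k * count M k + (if k = x then x else 0))"
    by (intro sum.cong) auto
  then show ?case using add by (simp add: sum.distrib)
qed simp

lemma z_part_eq_prod:
  assumes "finite A" "set_mset M \<subseteq> A"
  shows "z_part M = (\<Prod>i\<in>A. i ^ count M i * fact (count M i))"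
  unfolding z_part_def
  by (rule prod.mono_neutral_left) (use assms in \<open>auto simp: not_in_iff\<close>)

lemma z_part_add_mset: "z_part (add_mset k M) = k * Suc (count M k) * z_part M"
proof -
  let ?A = "set_mset M - {k}"
  let ?f = "\<lambda>M i. i ^ count M i * fact (count M i)"
  have "(\<Prod>i\<in>?A. ?f (add_mset k M) i) = (\<Prod>i\<in>?A. ?f M i)"
    by (intro prod.cong) auto
  moreover have "z_part N = ?f N k * (\<Prod>i\<in>?A. ?f N i)" if "set_mset N \<subseteq> insert k (set_mset M)" for N
  proof -
    have "z_part N = (\<Prod>i\<in>insert k ?A. ?f N i)"
      by (rule z_part_eq_prod) (use that in auto)
    then show ?thesis by (simp only: prod.insert finite_Diff finite_set_mset Diff_iff singletonI simp_thms)
  qed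
  ultimately show ?thesis by (simp add: subset_insertI algebra_simps)
qed

lemma z_part_pos: "0 \<notin># M \<Longrightarrow> z_part M > 0"
  unfolding z_part_def by (auto intro!: prod_pos Nat.gr0I)

lemma finite_partitions_of: "finite (partitions_of n)"
proof (induction n rule: less_induct)
  case (less n)
  have "partitions_of n \<subseteq> insert {#} (\<Union>k\<in>{1..n}. add_mset k ` partitions_of (n - k))"
  proof
    fix M assume M: "M \<in> partitions_of n"
    show "M \<in> insert {#} (\<Union>k\<in>{1..n}. add_mset k ` partitions_of (n - k))"
    proof (cases M)
      case (add k N)
      then have "k \<in> {1..n}" "N \<in> partitions_of (n - k)"
        using M by (auto simp: partitions_of_def intro: Suc_leI gr0I)
      then show ?thesis using add by blast
    qed simp
  qed
  moreover have "finite (\<Union>k\<in>{1..n}. add_mset k ` partitions_of (n - k))"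
    using less by auto
  ultimately show ?case by (meson finite_insert finite_subset)
qed

text \<open>If the \<open>p k\<close> are power sums, this is the complete homogeneous symmetric
  function of degree \<open>n\<close>.\<close>

definition partition_sum :: "(nat \<Rightarrow> 'a) \<Rightarrow> nat \<Rightarrow> 'a::field_char_0" where
  "partition_sum p n = (\<Sum>M\<in>partitions_of n. (\<Prod>k\<in>#M. p k) / of_nat (z_part M))"

lemma partition_sum_0: "partition_sum p 0 = 1"
proof -
  have "partitions_of 0 = {{#}}"
    by (auto simp: partitions_of_def) (metis multiset_nonemptyE)
  then show ?thesis by (simp add: partition_sum_def z_part_def)
qed

text \<open>Newton's identity: write \<open>n\<close> as the sum of \<open>k\<close> times the
  multiplicity of \<open>k\<close>. Removing one copy of \<open>k\<close> from the partition divides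
  \<open>z_part\<close> by exactly this factor.\<close>

lemma newton_partition_sum:
  "of_nat n * partition_sum p n = (\<Sum>k=1..n. p k * partition_sum p (n - k))"
proof -
  let ?t = "\<lambda>M. (\<Prod>k\<in>#M. p k) / of_nat (z_part M)"
  have "of_nat n * partition_sum p n =
      (\<Sum>M\<in>partitions_of n. \<Sum>k\<in>set_mset M. of_nat (k * count M k) * ?t M)"
    unfolding partition_sum_def sum_distrib_left
  proof (rule sum.cong)
    fix M assume "M \<in> partitions_of n"
    then have "n = (\<Sum>k\<in>set_mset M. k * count M k)"
      using sum_mset_eq_sum_count[of "set_mset M" M] by (simp add: partitions_of_def)
    then have "of_nat n = (\<Sum>k\<in>set_mset M. of_nat (k * count M k) :: 'a)"
      by (metis of_nat_sum)
    then show "of_nat n * ?t M = (\<Sum>k\<in>set_mset M. of_nat (k * count M k) * ?t M)"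
      by (simp only: sum_distrib_right)
  qed simp
  also have "\<dots> = (\<Sum>(M, k)\<in>(SIGMA M:partitions_of n. set_mset M). of_nat (k * count M k) * ?t M)"
    by (subst sum.Sigma) (auto simp: finite_partitions_of)
  also have "\<dots> = (\<Sum>(k, M)\<in>(SIGMA k:{1..n}. partitions_of (n - k)). p k * ?t M)"
  proof (rule sum.reindex_bij_witness[where j = "\<lambda>(M, k). (k, M - {#k#})"
      and i = "\<lambda>(k, M). (add_mset k M, k)"], goal_cases)
    case (1 q)
    then show ?case by (auto simp: case_prod_beta)
  next
    case (3 q)
    then show ?case by (simp add: case_prod_beta)
  next
    case (2 q)
    then obtain M k N where q: "q = (M, k)" "M \<in> partitions_of n" "M = add_mset k N"
      by (auto dest: multi_member_split)
    then show ?case by (auto simp: partitions_of_def intro: Suc_leI gr0I)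
  next
    case (4 q)
    then show ?case by (auto simp: partitions_of_def)
  next
    case (5 q)
    then obtain M k N where q: "q = (M, k)" "M \<in> partitions_of n" "M = add_mset k N"
      by (auto dest: multi_member_split)
    then have "k \<noteq> 0" "0 \<notin># N" by (auto simp: partitions_of_def)
    define c :: 'a where "c = of_nat (k * count M k)"
    have "z_part M = k * count M k * z_part N"
      using q(3) by (simp add: z_part_add_mset)
    then have "of_nat (z_part M) = c * of_nat (z_part N)"
      by (simp only: c_def of_nat_mult)
    moreover have "c \<noteq> 0"
      unfolding c_def of_nat_eq_0_iff using q(3) \<open>k \<noteq> 0\<close> by simp
    ultimately have "c * ?t M = p k * ?t N"
      using q(3) by simp
    then show ?case using q(1,3) by (simp only: c_def case_prod_conv add_mset_remove_trivial)
  qed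
  also have "\<dots> = (\<Sum>k=1..n. p k * partition_sum p (n - k))"
    unfolding partition_sum_def sum_distrib_left
    by (subst sum.Sigma) (auto simp: finite_partitions_of)
  finally show ?thesis .
qed

text \<open>\<open>H = exp (\<Sum>k\<ge>1. p k X^k / k)\<close>, stated through the logarithmic derivative.\<close>

definition power_sums :: "'a::comm_ring_1 fps \<Rightarrow> (nat \<Rightarrow> 'a) \<Rightarrow> bool" where
  "power_sums H p \<longleftrightarrow> H $ 0 = 1 \<and> fps_deriv H = H * Abs_fps (\<lambda>k. p (Suc k))"

text \<open>Comparing coefficients in the logarithmic derivative gives Newton's recurrence, which
  determines \<open>H\<close> since positive integers are invertible in characteristic zero.\<close>

lemma power_sums_nth:
  fixes H :: "'a::field_char_0 fps"
  assumes "power_sums H p"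
  shows "H $ n = partition_sum p n"
proof (induction n rule: less_induct)
  case (less n)
  show ?case
  proof (cases n)
    case 0
    then show ?thesis using assms by (simp add: power_sums_def partition_sum_0)
  next
    case (Suc m)
    have "of_nat n * H $ n = fps_deriv H $ m" by (simp add: Suc)
    also have "\<dots> = (Abs_fps (\<lambda>k. p (Suc k)) * H) $ m"
      using assms by (simp add: power_sums_def mult.commute)
    also have "\<dots> = (\<Sum>k=0..m. p (Suc k) * H $ (m - k))"
      by (simp add: fps_mult_nth)
    also have "\<dots> = (\<Sum>k=0..m. p (Suc k) * partition_sum p (n - Suc k))"
      by (rule sum.cong) (auto simp: Suc less)
    also have "\<dots> = (\<Sum>k=1..n. p k * partition_sum p (n - k))"
      using sum.shift_bounds_cl_Suc_ivl[of "\<lambda>k. p k * partition_sum p (n - k)" 0 m] by (simp add: Suc)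
    also have "\<dots> = of_nat n * partition_sum p n" by (rule newton_partition_sum[symmetric])
    finally show ?thesis using Suc by (simp del: of_nat_Suc)
  qed
qed

lemma power_sums_1: "power_sums 1 (\<lambda>_. 0)"
  by (simp add: power_sums_def fps_eq_iff fps_mult_nth)

lemma power_sums_mult:
  assumes "power_sums G p" "power_sums H q"
  shows "power_sums (G * H) (\<lambda>k. p k + q k)"
proof -
  have "Abs_fps (\<lambda>k. p (Suc k) + q (Suc k)) = Abs_fps (\<lambda>k. p (Suc k)) + Abs_fps (\<lambda>k. q (Suc k))"
    by (simp add: fps_eq_iff)
  then show ?thesis using assms by (simp add: power_sums_def algebra_simps)
qed

lemma power_sums_power:
  "power_sums H p \<Longrightarrow> power_sums (H ^ m) (\<lambda>k. of_nat m * p k)"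
proof (induction m)
  case (Suc m)
  from power_sums_mult[OF Suc.prems Suc.IH[OF Suc.prems]] show ?case by (simp add: algebra_simps)
qed (simp add: power_sums_1)

text \<open>The coefficient of X^k in log (1 + c X) is - (- c)^k / k.\<close>

lemma power_sums_linear: "power_sums (1 + fps_const c * fps_X) (\<lambda>k. - ((- c) ^ k))"
proof -
  have "((1 + fps_const c * fps_X) * Abs_fps (\<lambda>k. - ((- c) ^ Suc k))) $ n = fps_const c $ n" for n
    by (cases n) (simp_all add: distrib_right mult.assoc)
  then show ?thesis by (simp add: power_sums_def fps_eq_iff)
qed

lemma power_sums_inverse_linear:
  fixes c :: "'a::field"
  shows "power_sums (inverse (1 - fps_const c * fps_X)) (\<lambda>k. c ^ k)"
proof -
  let ?q = "1 - fps_const c * fps_X :: 'a fps"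
  have inv: "inverse ?q * ?q = 1" by (rule inverse_mult_eq_1) simp
  have "(?q * Abs_fps (\<lambda>k. c ^ Suc k)) $ n = fps_const c $ n" for n
    by (cases n) (simp_all add: left_diff_distrib mult.assoc)
  then have "?q * Abs_fps (\<lambda>k. c ^ Suc k) = fps_const c" by (simp add: fps_eq_iff)
  then have "inverse ?q * ?q * Abs_fps (\<lambda>k. c ^ Suc k) = inverse ?q * fps_const c"
    by (simp only: mult.assoc)
  then have "Abs_fps (\<lambda>k. c ^ Suc k) = inverse ?q * fps_const c"
    by (simp only: inv mult_1)
  then show ?thesis
    by (simp add: power_sums_def fps_inverse_deriv power2_eq_square)
qed

section \<open>Closed forms in the statistics\<close>

lemma fps_const_sum: "fps_const (sum f A) = (\<Sum>x\<in>A. fps_const (f x))"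
  by (induction A rule: infinite_finite_induct) (simp_all flip: fps_const_add)

lemma fps_const_prod: "fps_const (prod f A) = (\<Prod>x\<in>A. fps_const (f x))"
  by (induction A rule: infinite_finite_induct) (simp_all flip: fps_const_mult)

lemma filling_sum_fps_const:
  "filling_sum \<sigma> (\<lambda>m. fps_const (w m)) a n \<pi> = fps_const (filling_sum \<sigma> w a n \<pi>)"
  by (simp add: filling_sum_def chain_sum_def fps_const_sum fps_const_prod)

text \<open>By \<open>updown_ending_gf_Suc\<close> a step contributes r (1 + X^2) without a turn and
  2 X r with one, so each turn costs the factor 2 X q. The inverses enter through equations because
  the coefficients will themselves be series.\<close>

lemma updown_closed_form:
  fixes r q :: "'a::comm_ring_1 fps"
  assumes r: "r * (1 - fps_X\<^sup>2) = 1" and q: "q * (1 + fps_X\<^sup>2) = 1"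
    and "inj_on \<pi> {1..Suc k}"
  shows "(1 + fps_X\<^sup>2) ^ Suc k * r ^ k * (2 * fps_X * q) ^ udr (Suc k) \<pi> =
    2 * (1 - fps_X) * fps_X * Abs_fps (updown_ending \<pi> k)"
  using assms(3)
proof (induction k)
  case 0
  have "Abs_fps (updown_ending \<pi> 0) * (1 - fps_X) = (1 :: 'a fps)"
  proof -
    have "updown_ending \<pi> 0 = (\<lambda>_. 1 :: 'a)" by (simp add: fun_eq_iff)
    then show ?thesis by (simp only: fps_geometric)
  qed
  moreover have "(1 + fps_X\<^sup>2) ^ Suc 0 * r ^ 0 * (2 * fps_X * q) ^ udr (Suc 0) \<pi> =
      2 * fps_X * (q * (1 + fps_X\<^sup>2))"
    by (simp add: udr_1 algebra_simps)
  moreover have "2 * (1 - fps_X) * fps_X * Abs_fps (updown_ending \<pi> 0) =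
      2 * fps_X * (Abs_fps (updown_ending \<pi> 0) * (1 - fps_X) :: 'a fps)"
    by (simp only: mult_ac)
  ultimately show ?case by (simp only: q)
next
  case (Suc k)
  let ?U = "\<lambda>k. Abs_fps (updown_ending \<pi> k) :: 'a fps"
  let ?same = "(k = 0 \<or> \<pi> k < \<pi> (Suc k)) = (\<pi> (Suc k) < \<pi> (Suc (Suc k)))"
  let ?c = "if ?same then 1 + fps_X\<^sup>2 else 2 * fps_X :: 'a fps"
  have inj: "inj_on \<pi> {1..Suc k}" using Suc.prems by (rule inj_on_subset) auto
  have "?U (Suc k) = ?U (Suc k) * (r * (1 - fps_X\<^sup>2))" by (simp only: r mult_1_right)
  also have "\<dots> = ?U (Suc k) * (1 - fps_X\<^sup>2) * r" by (simp only: mult_ac)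
  also have "\<dots> = ?c * ?U k * r" by (simp only: updown_ending_gf_Suc)
  also have "\<dots> = r * ?c * ?U k" by (simp only: mult_ac)
  finally have U: "?U (Suc k) = r * ?c * ?U k" .
  have c: "(1 + fps_X\<^sup>2) * (2 * fps_X * q) ^ (if ?same then 0 else 1) = ?c"
  proof (cases ?same)
    case False
    have "(1 + fps_X\<^sup>2) * (2 * fps_X * q) = 2 * fps_X * (q * (1 + fps_X\<^sup>2))" by (simp only: mult_ac)
    then show ?thesis using False q by simp
  qed simp
  have "(1 + fps_X\<^sup>2) ^ Suc (Suc k) * r ^ Suc k * (2 * fps_X * q) ^ udr (Suc (Suc k)) \<pi> =
      ((1 + fps_X\<^sup>2) ^ Suc k * r ^ k * (2 * fps_X * q) ^ udr (Suc k) \<pi>) * r *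
      ((1 + fps_X\<^sup>2) * (2 * fps_X * q) ^ (if ?same then 0 else 1))"
    unfolding udr_Suc[OF Suc.prems] power_add by (simp only: power_Suc mult_ac)
  also have "\<dots> = 2 * (1 - fps_X) * fps_X * ?U (Suc k)"
    unfolding Suc.IH[OF inj] c U by (simp only: mult_ac)
  finally show ?case .
qed

text \<open>E k + N k equals (1 + y t) N k after an ascent and (1 + y) N k otherwise. Hence a step
  multiplies it by (1 + y t) r at an ascent, by (y + t) r at a descent that makes no peak, and by (1
  + y)^2 t r / (1 + y t) at a peak. The weights \<beta> of a descent and \<alpha> of a peak encode
  these ratios.\<close>

lemma peak_descent_closed_form:
  fixes E N :: "nat \<Rightarrow> 'a::comm_ring_1"
  assumes r: "r * (1 - t) = 1"
    and \<beta>: "\<beta> * (1 + y * t) = y + t"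
    and \<alpha>: "\<alpha> * ((y + t) * (1 + y * t)) = (1 + y)\<^sup>2 * t"
    and N0: "N 0 * (1 - t) = 1"
    and N_Suc: "\<And>k. N (Suc k) * (1 - t) = E k + (if \<pi> (Suc k) < \<pi> (Suc (Suc k)) then 1 else t) * N k"
    and asc: "\<And>k. k \<noteq> 0 \<Longrightarrow> \<pi> k < \<pi> (Suc k) \<Longrightarrow> E k = y * t * N k"
    and desc: "\<And>k. k = 0 \<or> \<not> \<pi> k < \<pi> (Suc k) \<Longrightarrow> E k = y * N k"
    and "inj_on \<pi> {1..Suc k}"
  shows "((1 + y * t) * r) ^ (Suc k + 1) * \<alpha> ^ (pk (Suc k) \<pi> + 1) * \<beta> ^ (des (Suc k) \<pi> + 1) * (1 - t) =
    (1 + y) * t * (E k + N k)"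
  using assms(8)
proof (induction k)
  case 0
  have "N 0 = N 0 * (r * (1 - t))" using r by simp
  also have "\<dots> = r * (N 0 * (1 - t))" by (simp only: mult_ac)
  finally have N: "N 0 = r" using N0 by simp
  have "((1 + y * t) * r) ^ (Suc 0 + 1) * \<alpha> ^ (pk (Suc 0) \<pi> + 1) * \<beta> ^ (des (Suc 0) \<pi> + 1) * (1 - t) =
     (\<alpha> * (\<beta> * (1 + y * t) * (1 + y * t))) * r * (r * (1 - t))"
    by (simp add: pk_1 des_1 algebra_simps)
  also have "\<dots> = (1 + y) * t * (E 0 + N 0)"
    unfolding \<beta> \<alpha> r using desc[of 0] N by (simp add: power2_eq_square algebra_simps)
  finally show ?case .
next
  case (Suc k)
  let ?L = "\<lambda>k. ((1 + y * t) * r) ^ (Suc k + 1) * \<alpha> ^ (pk (Suc k) \<pi> + 1) * \<beta> ^ (des (Suc k) \<pi> + 1) * (1 - t)"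
  have inj: "inj_on \<pi> {1..Suc k}" using Suc.prems by (rule inj_on_subset) auto
  have ne: "\<pi> (Suc k) \<noteq> \<pi> (Suc (Suc k))"
    using inj_onD[OF Suc.prems, of "Suc k" "Suc (Suc k)"] by auto
  have IH: "?L k = (1 + y) * t * (E k + N k)" by (rule Suc.IH[OF inj])
  have "N (Suc k) = N (Suc k) * (r * (1 - t))" by (simp only: r mult_1_right)
  then have "N (Suc k) = N (Suc k) * (1 - t) * r" by (simp only: mult_ac)
  then have N: "N (Suc k) = (E k + (if \<pi> (Suc k) < \<pi> (Suc (Suc k)) then 1 else t) * N k) * r"
    by (simp only: N_Suc)
  show ?case
  proof (cases "\<pi> (Suc k) < \<pi> (Suc (Suc k))")
    case True
    then have "?L (Suc k) = ?L k * ((1 + y * t) * r)"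
      by (simp add: pk_Suc des_Suc mult_ac)
    also have "\<dots> = (1 + y) * t * (E (Suc k) + N (Suc k))"
      unfolding IH using asc[of "Suc k"] True N by (simp add: algebra_simps)
    finally show ?thesis .
  next
    case False
    then have gt: "\<pi> (Suc k) > \<pi> (Suc (Suc k))" using ne by simp
    have E': "E (Suc k) = y * N (Suc k)" using desc False by blast
    have N': "N (Suc k) = (E k + t * N k) * r" using N False by simp
    show ?thesis
    proof (cases "k \<noteq> 0 \<and> \<pi> k < \<pi> (Suc k)")
      case True
      then have "?L (Suc k) = ?L k * ((1 + y * t) * r) * \<alpha> * \<beta>"
        using gt by (simp add: pk_Suc des_Suc mult_ac)
      \<comment> \<open>The ascent before the peak gives E k + N k = (1 + y t) N k, and the factor 1
        + y t clears the denominators of \<alpha> and \<beta>.\<close>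
      also have "\<dots> = (1 + y) * t * N k * r * (\<alpha> * (\<beta> * (1 + y * t) * (1 + y * t)))"
        unfolding IH using asc[of k] True by (simp add: algebra_simps)
      also have "\<dots> = (1 + y) * t * (E (Suc k) + N (Suc k))"
        unfolding \<beta> \<alpha> E' N' using asc[of k] True by (simp add: power2_eq_square algebra_simps)
      finally show ?thesis .
    next
      case False
      then have "pk (Suc (Suc k)) \<pi> = pk (Suc k) \<pi>" by (auto simp: pk_Suc)
      then have "?L (Suc k) = ?L k * r * (\<beta> * (1 + y * t))"
        using gt by (simp add: des_Suc mult_ac)
      also have "\<dots> = (1 + y) * t * (E (Suc k) + N (Suc k))"
        unfolding IH \<beta> E' N' using desc[of k] False by (simp add: algebra_simps)
      finally show ?thesis .
    qed
  qed
qed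

lemma fps_nth_compose_X_square:
  fixes f :: "'a::comm_ring_1 fps"
  shows "(f oo fps_X\<^sup>2) $ n = (if even n then f $ (n div 2) else 0)"
proof -
  have "(f oo fps_X\<^sup>2) $ n = (\<Sum>i=0..n. if n = 2 * i then f $ i else 0)"
    unfolding fps_compose_nth by (rule sum.cong) (auto simp: power_mult[symmetric] fps_X_power_nth)
  also have "\<dots> = (\<Sum>i\<in>{0..n} \<inter> {i. n = 2 * i}. f $ i)"
    by (simp add: sum.inter_restrict)
  also have "{0..n} \<inter> {i. n = 2 * i} = (if even n then {n div 2} else {})"
    by auto
  finally show ?thesis by simp
qed

section \<open>Series in all variables\<close>

lemma series_unit_nonzero: "g $ 0 $ 0 $ 0 \<noteq> 0 \<Longrightarrow> g \<noteq> (0 :: series)"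
  by auto

lemma series_divide_eqI:
  fixes f g h :: series
  assumes "g $ 0 $ 0 $ 0 \<noteq> 0" "h * g = f"
  shows "f / g = h"
  using series_divide_mult_cancel[OF assms(1), of f] assms series_unit_nonzero by auto

text \<open>The coefficient of s^a t^j on the right of (a), as a series in x: a = 2 i comes from the
  summand 1 and a = 2 i + 1 from the summand with s.\<close>

definition pair_series :: "'a \<Rightarrow> nat \<Rightarrow> nat \<Rightarrow> 'a::field fps" where
  "pair_series y a j =
     ((1 + fps_X) * (1 + fps_const y * fps_X) * inverse (1 - fps_const y * fps_X) * inverse (1 - fps_X)) ^ (a div 2 * j)
     * (if odd a then ((1 + fps_const y * fps_X) * inverse (1 - fps_X)) ^ j else 1)"

text \<open>The four factors of the first base add up to 1 - (-1)^k - (-y)^k + y^k, which factors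
  and vanishes for even k. This is why one sum of (b) is restricted to odd parts.\<close>

lemma power_sums_pair_series:
  "power_sums (pair_series y a j) (\<lambda>k. of_nat (a div 2 * j) * ((1 - (- 1) ^ k) * (1 - (- y) ^ k)) +
     (if odd a then of_nat j * (1 - (- y) ^ k) else 0))"
proof -
  have X: "power_sums (1 + fps_X :: 'a fps) (\<lambda>k. - ((- 1) ^ k))"
    using power_sums_linear[of "1 :: 'a"] by simp
  have iX: "power_sums (inverse (1 - fps_X :: 'a fps)) (\<lambda>_. 1)"
    using power_sums_inverse_linear[of "1 :: 'a"] by simp
  have "- ((- 1) ^ k) + - ((- y) ^ k) + y ^ k + 1 = (1 - (- 1) ^ k) * (1 - (- y) ^ k)" for k
    using power_mult_distrib[of "- 1" "- y" k] by (simp add: algebra_simps)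
  with power_sums_power[OF power_sums_mult[OF power_sums_mult[OF power_sums_mult[OF X
        power_sums_linear[of y]] power_sums_inverse_linear[of y]] iX], of "a div 2 * j"]
  have Z: "power_sums (((1 + fps_X) * (1 + fps_const y * fps_X) * inverse (1 - fps_const y * fps_X)
      * inverse (1 - fps_X)) ^ (a div 2 * j))
      (\<lambda>k. of_nat (a div 2 * j) * ((1 - (- 1) ^ k) * (1 - (- y) ^ k)))"
    by simp
  have R: "power_sums (((1 + fps_const y * fps_X) * inverse (1 - fps_X)) ^ j) (\<lambda>k. of_nat j * (1 - (- y) ^ k))"
    using power_sums_power[OF power_sums_mult[OF power_sums_linear[of y] iX], of j] by simp
  show ?thesis
  proof (cases "odd a")
    case True
    then show ?thesis using power_sums_mult[OF Z R] by (simp add: pair_series_def)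
  next
    case False
    then show ?thesis using Z by (simp add: pair_series_def)
  qed
qed

lemma prod_mset_if_odd:
  fixes p :: "nat \<Rightarrow> 'a::comm_ring_1"
  shows "(\<Prod>k\<in>#M. c * ((1 - (- 1) ^ k) * p k)) =
    (if \<forall>k\<in>#M. odd k then 2 ^ size M * c ^ size M * (\<Prod>k\<in>#M. p k) else 0)"
  by (induction M) (auto simp: algebra_simps)

lemma prod_mset_odd_weight:
  fixes p :: "nat \<Rightarrow> 'a::comm_ring_1"
  shows "(\<Prod>k\<in>#M. c * ((if odd k then d else 1) * p k)) =
    d ^ num_odd_parts M * c ^ size M * (\<Prod>k\<in>#M. p k)"
  by (induction M) (auto simp: algebra_simps num_odd_parts_def)

lemma pair_series_nth_even:
  fixes y :: "'a::field_char_0"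
  assumes "even a"
  shows "pair_series y a j $ n =
    (\<Sum>M | M \<in> partitions_of n \<and> (\<forall>k\<in>#M. odd k).
       2 ^ size M / of_nat (z_part M) * (\<Prod>k\<in>#M. 1 - (- y) ^ k) * of_nat ((a div 2) ^ size M) * of_nat (j ^ size M))"
proof -
  have "pair_series y a j $ n =
      partition_sum (\<lambda>k. of_nat (a div 2 * j) * ((1 - (- 1) ^ k) * (1 - (- y) ^ k))) n"
    using power_sums_nth[OF power_sums_pair_series[of y a j]] assms by simp
  also have "\<dots> = (\<Sum>M\<in>partitions_of n. if \<forall>k\<in>#M. odd k then
      2 ^ size M / of_nat (z_part M) * (\<Prod>k\<in>#M. 1 - (- y) ^ k) * of_nat ((a div 2) ^ size M) * of_nat (j ^ size M) else 0)"
    unfolding partition_sum_def prod_mset_if_odd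
    by (intro sum.cong) (auto simp: power_mult_distrib)
  also have "\<dots> = (\<Sum>M\<in>partitions_of n \<inter> {M. \<forall>k\<in>#M. odd k}.
      2 ^ size M / of_nat (z_part M) * (\<Prod>k\<in>#M. 1 - (- y) ^ k) * of_nat ((a div 2) ^ size M) * of_nat (j ^ size M))"
    by (subst sum.inter_restrict[OF finite_partitions_of]) (simp only: mem_Collect_eq)
  finally show ?thesis by (simp add: Int_def)
qed

text \<open>With a = 2 i + 1 the weight i (1 - (-1)^k) + 1 is \<open>a\<close> for odd k and 1 for
  even k, which leaves \<open>a\<close> to the number of odd parts.\<close>

lemma pair_series_nth_odd:
  fixes y :: "'a::field_char_0"
  assumes "odd a"
  shows "pair_series y a j $ n =
    (\<Sum>M\<in>partitions_of n.
       1 / of_nat (z_part M) * (\<Prod>k\<in>#M. 1 - (- y) ^ k) * of_nat (a ^ num_odd_parts M) * of_nat (j ^ size M))"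
proof -
  have a: "of_nat a = 2 * of_nat (a div 2) + (1 :: 'a)"
    using assms by (metis of_nat_1 of_nat_add of_nat_mult of_nat_numeral odd_two_times_div_two_succ)
  have "of_nat (a div 2 * j) * ((1 - (- 1) ^ k) * (1 - (- y) ^ k)) + of_nat j * (1 - (- y) ^ k) =
      of_nat j * ((if odd k then of_nat a else 1) * (1 - (- y) ^ k))" for k
    by (simp add: a algebra_simps)
  then have "pair_series y a j $ n =
      partition_sum (\<lambda>k. of_nat j * ((if odd k then of_nat a else 1) * (1 - (- y) ^ k))) n"
    using power_sums_nth[OF power_sums_pair_series[of y a j]] assms by simp
  also have "\<dots> = (\<Sum>M\<in>partitions_of n.
       1 / of_nat (z_part M) * (\<Prod>k\<in>#M. 1 - (- y) ^ k) * of_nat (a ^ num_odd_parts M) * of_nat (j ^ size M))"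
    unfolding partition_sum_def prod_mset_odd_weight by (intro sum.cong) auto
  finally show ?thesis .
qed

section \<open>Filling series in s and t\<close>

abbreviation (input) sv :: series where "sv \<equiv> fps_X"
abbreviation (input) tv :: series where "tv \<equiv> fps_const fps_X"
abbreviation (input) xv :: series where "xv \<equiv> fps_const (fps_const fps_X)"
abbreviation (input) yv :: series where "yv \<equiv> fps_const (fps_const (fps_const fls_X))"

text \<open>Each alphabet has its own variable, s for the size of the first and t for the number of
  pairs in the second, so a product of the two series records both sizes.\<close>

definition updown_gf :: "nat \<Rightarrow> (nat \<Rightarrow> nat) \<Rightarrow> series" where
  "updown_gf n \<pi> = Abs_fps (\<lambda>a. filling_sum even (\<lambda>_. 1) a n \<pi>)"

definition barred_gf :: "nat \<Rightarrow> (nat \<Rightarrow> nat) \<Rightarrow> series" where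
  "barred_gf n \<pi> = fps_const (Abs_fps (\<lambda>j.
     filling_sum odd (\<lambda>m. if odd m then 1 else fps_const fls_X) (2 * j) n \<pi>))"

text \<open>One factor 1 - s is the normalization in \<open>updown_closed_form\<close>; the other
  comes from passing from the last letter to the size of the alphabet.\<close>

lemma updown_gf_closed_form:
  assumes "inj_on \<pi> {1..Suc k}"
  shows "(1 + sv\<^sup>2) ^ Suc k / (1 - sv\<^sup>2) ^ k * (2 * sv / (1 + sv\<^sup>2)) ^ udr (Suc k) \<pi> =
    2 * (1 - sv)\<^sup>2 * updown_gf (Suc k) \<pi>"
proof -
  let ?U = "Abs_fps (updown_ending \<pi> k) :: series"
  define r :: series where "r = 1 / (1 - sv\<^sup>2)"
  define q :: series where "q = 1 / (1 + sv\<^sup>2)"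
  have r: "r * (1 - sv\<^sup>2) = 1" and q: "q * (1 + sv\<^sup>2) = 1"
    unfolding r_def q_def by (rule series_divide_mult_cancel, simp add: fps_X_power_nth)+
  have "(1 + sv\<^sup>2) ^ Suc k / (1 - sv\<^sup>2) ^ k = (1 + sv\<^sup>2) ^ Suc k * r ^ k"
  proof (rule series_divide_eqI)
    have "(1 + sv\<^sup>2) ^ Suc k * r ^ k * (1 - sv\<^sup>2) ^ k = (1 + sv\<^sup>2) ^ Suc k * (r * (1 - sv\<^sup>2)) ^ k"
      by (simp only: power_mult_distrib mult_ac)
    then show "(1 + sv\<^sup>2) ^ Suc k * r ^ k * (1 - sv\<^sup>2) ^ k = (1 + sv\<^sup>2) ^ Suc k"
      by (simp only: r power_one mult_1_right)
  qed (simp add: fps_power_zeroth fps_X_power_nth)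
  moreover have "2 * sv / (1 + sv\<^sup>2) = 2 * sv * q"
  proof (rule series_divide_eqI)
    show "2 * sv * q * (1 + sv\<^sup>2) = 2 * sv"
      by (simp only: mult.assoc q mult_1_right)
  qed (simp add: fps_X_power_nth)
  moreover have "(1 - sv)\<^sup>2 * updown_gf (Suc k) \<pi> = (1 - sv) * (updown_gf (Suc k) \<pi> * (1 - sv))"
    by (simp only: power2_eq_square mult_ac)
  moreover have "updown_gf (Suc k) \<pi> * (1 - sv) = sv * ?U"
    by (simp only: updown_gf_def filling_sum_Suc fps_partial_sums)
  ultimately show ?thesis
    using updown_closed_form[OF r q assms] by (simp only: mult.assoc)
qed

lemma fps_const_one_minus: "fps_const (1 - c) = 1 - fps_const (c :: 'a::ring_1)"
  by (simp flip: fps_const_sub)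

lemma barred_gf_closed_form:
  assumes "inj_on \<pi> {1..Suc k}"
  shows "((1 + yv * tv) / (1 - tv)) ^ (Suc k + 1) *
      ((1 + yv)\<^sup>2 * tv / ((yv + tv) * (1 + yv * tv))) ^ (pk (Suc k) \<pi> + 1) *
      ((yv + tv) / (1 + yv * tv)) ^ (des (Suc k) \<pi> + 1) =
    (1 + yv) * barred_gf (Suc k) \<pi>"
proof -
  let ?y = "fps_const fls_X :: rat fls fps"
  define E where "E k = fps_const (Abs_fps (\<lambda>m. barred_ending ?y \<pi> k (2 * m)))" for k
  define N where "N k = fps_const (Abs_fps (\<lambda>m. barred_ending ?y \<pi> k (Suc (2 * m))))" for k
  define r :: series where "r = 1 / (1 - tv)"
  have r: "r * (1 - tv) = 1"
    unfolding r_def by (rule series_divide_mult_cancel) simp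
  have rp: "(1 + yv * tv) / (1 - tv) = (1 + yv * tv) * r"
    by (rule series_divide_eqI) (simp_all only: mult.assoc r mult_1_right, simp)
  have \<beta>: "(yv + tv) / (1 + yv * tv) * (1 + yv * tv) = yv + tv"
    by (rule series_divide_mult_cancel) simp
  have \<alpha>: "(1 + yv)\<^sup>2 * tv / ((yv + tv) * (1 + yv * tv)) * ((yv + tv) * (1 + yv * tv)) = (1 + yv)\<^sup>2 * tv"
    by (rule series_divide_mult_cancel) simp
  have "barred_ending ?y \<pi> 0 (Suc (2 * m)) = 1" for m by simp
  then have N0: "N 0 * (1 - tv) = 1"
    unfolding N_def fps_const_one_minus[symmetric] fps_const_mult
    by (simp only: fps_geometric fps_const_1_eq_1)
  have N_Suc: "N (Suc k) * (1 - tv) = E k + (if \<pi> (Suc k) < \<pi> (Suc (Suc k)) then 1 else tv) * N k" for k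
    using arg_cong[OF barred_ending_gf_Suc[of ?y \<pi> k], of fps_const]
    by (simp add: E_def N_def fps_const_one_minus flip: fps_const_mult fps_const_add
        split: if_splits)
  have asc: "E k = yv * tv * N k" if "k \<noteq> 0" "\<pi> k < \<pi> (Suc k)" for k
    using arg_cong[OF barred_ending_asc[OF that, of ?y], of fps_const]
    by (simp only: E_def N_def fps_const_mult)
  have desc: "E k = yv * N k" if "k = 0 \<or> \<not> \<pi> k < \<pi> (Suc k)" for k
    using arg_cong[OF barred_ending_desc[OF that, of ?y], of fps_const]
    by (simp only: E_def N_def fps_const_mult)
  have "barred_gf (Suc k) \<pi> * (1 - tv) = tv * (E k + N k)"
    unfolding barred_gf_def filling_sum_Suc E_def N_def fps_const_one_minus[symmetric] fps_const_mult
      fps_const_add barred_filling_gf ..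
  then have "(1 + yv) * barred_gf (Suc k) \<pi> * (1 - tv) = (1 + yv) * tv * (E k + N k)"
    by (simp only: mult.assoc)
  moreover have "1 - tv \<noteq> 0" by (rule series_unit_nonzero) simp
  ultimately show ?thesis
    using peak_descent_closed_form[OF r \<beta> \<alpha> N0 N_Suc asc desc assms] unfolding rp
    by (metis mult_right_cancel)
qed

text \<open>The prefactor splits into a part in s, which turns the weight of \<open>udr\<close> into
  \<open>updown_gf\<close>, and a part in t and y, which does the same for the peaks and descents of
  the inverse. The common factor \<open>?D\<close> then cancels.\<close>

lemma permutation_series:
  assumes "n \<ge> 1"
  shows "(1 + sv\<^sup>2) ^ n / (1 - sv\<^sup>2) ^ (n - 1) * ((1 + yv * tv) / (1 - tv)) ^ (n + 1)
      * (P_udr_ipk_ides n (2 * sv / (1 + sv\<^sup>2))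
          ((1 + yv)\<^sup>2 * tv / ((yv + tv) * (1 + yv * tv))) ((yv + tv) / (1 + yv * tv))
        / (2 * (1 - sv)\<^sup>2 * (1 + yv))) =
    (\<Sum>\<pi> | \<pi> permutes {1..n}. updown_gf n \<pi> * barred_gf n (inv \<pi>))"
    (is "?A * ?B * (?P / ?D) = ?R")
proof -
  obtain k where n: "n = Suc k" using assms by (cases n) auto
  let ?s = "2 * sv / (1 + sv\<^sup>2)"
  let ?\<alpha> = "(1 + yv)\<^sup>2 * tv / ((yv + tv) * (1 + yv * tv))"
  let ?\<beta> = "(yv + tv) / (1 + yv * tv)"
  \<comment> \<open>The constant coefficient of \<open>?D\<close> is 2 (1 + y), which must be
    nonzero in the field of Laurent series.\<close>
  have y: "1 + fls_X \<noteq> (0 :: rat fls)"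
  proof
    assume "1 + fls_X = (0 :: rat fls)"
    then have "fls_nth (1 + fls_X) 0 = fls_nth (0 :: rat fls) 0" by (rule arg_cong)
    then show False by simp
  qed
  have "2 * (1 + fls_X) \<noteq> (0 :: rat fls)" by (rule no_zero_divisors[OF _ y]) simp
  then have D: "?D $ 0 $ 0 $ 0 \<noteq> 0"
    by (simp add: power2_eq_square distrib_left)
  have "?A * ?B * ?P = (\<Sum>\<pi> | \<pi> permutes {1..n}.
      (?A * ?s ^ udr n \<pi>) * (?B * ?\<alpha> ^ (pk n (inv \<pi>) + 1) * ?\<beta> ^ (des n (inv \<pi>) + 1)))"
    unfolding P_udr_ipk_ides_def sum_distrib_left ipk_def ides_def by (simp only: mult_ac)
  also have "\<dots> = (\<Sum>\<pi> | \<pi> permutes {1..n}. updown_gf n \<pi> * barred_gf n (inv \<pi>) * ?D)"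
  proof (rule sum.cong)
    fix \<pi> assume "\<pi> \<in> {\<pi>. \<pi> permutes {1..n}}"
    then have \<pi>: "\<pi> permutes {1..n}" by simp
    have "inj_on \<pi> {1..Suc k}" "inj_on (inv \<pi>) {1..Suc k}"
      using permutes_inj_on[OF \<pi>] permutes_inj_on[OF permutes_inv[OF \<pi>]] by auto
    from updown_gf_closed_form[OF this(1)] barred_gf_closed_form[OF this(2)]
    have "?A * ?s ^ udr n \<pi> = 2 * (1 - sv)\<^sup>2 * updown_gf n \<pi>"
      "?B * ?\<alpha> ^ (pk n (inv \<pi>) + 1) * ?\<beta> ^ (des n (inv \<pi>) + 1) = (1 + yv) * barred_gf n (inv \<pi>)"
      by (simp_all only: n diff_Suc_1)
    then show "(?A * ?s ^ udr n \<pi>) * (?B * ?\<alpha> ^ (pk n (inv \<pi>) + 1) * ?\<beta> ^ (des n (inv \<pi>) + 1)) =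
        updown_gf n \<pi> * barred_gf n (inv \<pi>) * ?D"
      by (simp only: mult_ac)
  qed simp
  also have "\<dots> = ?R * ?D"
    by (simp only: sum_distrib_right)
  finally have "?A * ?B * (?P / ?D) * ?D = ?R * ?D"
    using series_divide_mult_cancel[OF D, of ?P] by (simp only: mult.assoc)
  then show ?thesis
    by (rule mult_right_cancel[OF series_unit_nonzero[OF D], THEN iffD1])
qed

section \<open>Coefficients of the two sides of (a)\<close>

lemma filling_sum_one: "filling_sum \<sigma> (\<lambda>_. 1) a n \<pi> = fps_const (filling_sum \<sigma> (\<lambda>_. 1) a n \<pi>)"
  using filling_sum_fps_const[of \<sigma> "\<lambda>_. 1" a n \<pi>] by simp

text \<open>Taking the coefficient of s^a t^j fixes both alphabets, so the product formula applies.
  The filling sums involve only y, hence the constant in x.\<close>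

lemma nth_updown_barred:
  "(\<Sum>\<pi> | \<pi> permutes {1..n}. updown_gf n \<pi> * barred_gf n (inv \<pi>)) $ a $ j =
    fps_const (pair_series fls_X a j $ n)"
proof -
  have "barred_gf n \<pi> $ 0 $ j = fps_const (filling_sum odd (\<lambda>m. if odd m then 1 else fls_X) (2 * j) n \<pi>)" for \<pi>
  proof -
    have "filling_sum odd (\<lambda>m. if odd m then 1 else fps_const fls_X) (2 * j) n \<pi> =
        filling_sum odd (\<lambda>m. fps_const (if odd m then 1 else fls_X :: rat fls)) (2 * j) n \<pi>"
      by (rule arg_cong[of _ _ "\<lambda>w. filling_sum odd w (2 * j) n \<pi>"]) auto
    also have "\<dots> = fps_const (filling_sum odd (\<lambda>m. if odd m then 1 else fls_X) (2 * j) n \<pi>)"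
      by (rule filling_sum_fps_const)
    finally show ?thesis by (simp add: barred_gf_def)
  qed
  moreover have "updown_gf n \<pi> $ a = fps_const (fps_const (filling_sum even (\<lambda>_. 1) a n \<pi>))" for \<pi>
    by (simp add: updown_gf_def filling_sum_one[where 'a = "rat fls"] filling_sum_one[where 'a = "rat fls fps"])
  moreover have "(updown_gf n \<pi> * barred_gf n \<rho>) $ a = updown_gf n \<pi> $ a * barred_gf n \<rho> $ 0" for \<pi> \<rho>
    by (simp add: barred_gf_def)
  ultimately have "(\<Sum>\<pi> | \<pi> permutes {1..n}. updown_gf n \<pi> * barred_gf n (inv \<pi>)) $ a $ j =
      fps_const (\<Sum>\<pi> | \<pi> permutes {1..n}. filling_sum even (\<lambda>_. 1) a n \<pi> *
        filling_sum odd (\<lambda>m. if odd m then 1 else fls_X) (2 * j) n (inv \<pi>))"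
    by (simp add: fps_sum_nth fps_const_sum)
  also have "\<dots> = fps_const (pair_series fls_X a j $ n)"
    unfolding pair_series_def updown_barred_gf[symmetric] by simp
  finally show ?thesis .
qed

text \<open>In both sums of (a) a monomial determines the only index that can contribute to it, here
  \<open>g a b c\<close>.\<close>

lemma formal_sum_single:
  assumes "\<And>i a b c. i \<in> I \<Longrightarrow> f i $ a $ b $ c \<noteq> 0 \<Longrightarrow> i = g a b c"
  shows "formally_summable_on f I"
    and "formal_sum f I $ a $ b $ c = (if g a b c \<in> I then f (g a b c) $ a $ b $ c else 0)"
proof -
  have sub: "{i \<in> I. f i $ a $ b $ c \<noteq> 0} \<subseteq> {g a b c} \<inter> I" for a b c
    using assms by auto
  then show "formally_summable_on f I"
    unfolding formally_summable_on_def by (meson finite.emptyI finite_insert finite_Int finite_subset)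
  have "formal_sum f I $ a $ b $ c = (\<Sum>i\<in>{i \<in> I. f i $ a $ b $ c \<noteq> 0}. f i $ a $ b $ c)"
    by (simp add: formal_sum_def)
  also have "\<dots> = (\<Sum>i\<in>{g a b c} \<inter> I. f i $ a $ b $ c)"
    by (rule sum.mono_neutral_left) (use sub in auto)
  finally show "formal_sum f I $ a $ b $ c = (if g a b c \<in> I then f (g a b c) $ a $ b $ c else 0)"
    by simp
qed

lemma pair_series_0 [simp]: "pair_series y a j $ 0 = 1"
  using power_sums_pair_series[of y a j] by (simp add: power_sums_def)

text \<open>The term for x^0 on the left of (a); its counterpart on the right is
  \<open>pair_series_0\<close>.\<close>

lemma inverse_geometric_product: "(1 / ((1 - sv) * (1 - tv))) $ a $ b = 1"
proof -
  have t: "fps_const (Abs_fps (\<lambda>_. 1)) * (1 - tv) = (1 :: series)"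
    unfolding fps_const_one_minus[symmetric] fps_const_mult
    by (simp only: fps_geometric fps_const_1_eq_1)
  have "1 / ((1 - sv) * (1 - tv)) = Abs_fps (\<lambda>_. 1) * fps_const (Abs_fps (\<lambda>_. 1))"
  proof (rule series_divide_eqI)
    have "Abs_fps (\<lambda>_. 1) * fps_const (Abs_fps (\<lambda>_. 1)) * ((1 - sv) * (1 - tv)) =
        (Abs_fps (\<lambda>_. 1) * (1 - sv)) * (fps_const (Abs_fps (\<lambda>_. 1)) * (1 - tv))"
      by (simp only: mult_ac)
    then show "Abs_fps (\<lambda>_. 1) * fps_const (Abs_fps (\<lambda>_. 1)) * ((1 - sv) * (1 - tv)) = 1"
      by (simp only: t fps_geometric mult_1_right)
  qed simp
  then show ?thesis by simp
qed

text \<open>The factor 1 + s R^j separates even from odd powers of s, so \<open>a\<close> determines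
  i as \<open>a div 2\<close>, while the power of t determines j.\<close>

lemma nth_pair_term:
  "(((1 + xv) * (1 + yv * xv) / ((1 - yv * xv) * (1 - xv))) ^ (i * j)
     * (1 + sv * ((1 + yv * xv) / (1 - xv)) ^ j) * sv ^ (2 * i) * tv ^ j) $ a $ b =
   (if (i, j) = (a div 2, b) then pair_series fls_X a b else 0)"
proof -
  let ?y = "fps_const fls_X :: rat fls fps"
  let ?c = "\<lambda>f. fps_const (fps_const f) :: series"
  define R where "R = (1 + ?y * fps_X) * inverse (1 - fps_X)"
  define Z where "Z = (1 + fps_X) * (1 + ?y * fps_X) * inverse (1 - ?y * fps_X) * inverse (1 - fps_X)"
  have c_1: "1 = ?c 1" by simp
  have i1: "inverse (1 - fps_X) * (1 - fps_X) = (1 :: rat fls fps)"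
    by (rule inverse_mult_eq_1) simp
  have iy: "inverse (1 - ?y * fps_X) * (1 - ?y * fps_X) = 1"
    by (rule inverse_mult_eq_1) simp
  have R: "(1 + yv * xv) / (1 - xv) = ?c R"
  proof (rule series_divide_eqI)
    have "R * (1 - fps_X) = 1 + ?y * fps_X"
      by (simp only: R_def mult.assoc i1 mult_1_right)
    then show "?c R * (1 - xv) = 1 + yv * xv"
      unfolding c_1 fps_const_mult fps_const_add fps_const_sub by (rule arg_cong)
  qed simp
  have Z: "(1 + xv) * (1 + yv * xv) / ((1 - yv * xv) * (1 - xv)) = ?c Z"
  proof (rule series_divide_eqI)
    have "Z * ((1 - ?y * fps_X) * (1 - fps_X)) = (1 + fps_X) * (1 + ?y * fps_X) *
        (inverse (1 - ?y * fps_X) * (1 - ?y * fps_X)) * (inverse (1 - fps_X) * (1 - fps_X))"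
      by (simp only: Z_def mult_ac)
    also have "\<dots> = (1 + fps_X) * (1 + ?y * fps_X)"
      by (simp only: i1 iy mult_1_right)
    finally show "?c Z * ((1 - yv * xv) * (1 - xv)) = (1 + xv) * (1 + yv * xv)"
      unfolding c_1 fps_const_mult fps_const_add fps_const_sub by (rule arg_cong)
  qed simp
  have "?c Z ^ (i * j) * (1 + sv * ?c R ^ j) * sv ^ (2 * i) * tv ^ j =
      fps_const (fps_const (Z ^ (i * j)) * fps_X ^ j) * sv ^ (2 * i) +
      fps_const (fps_const (Z ^ (i * j) * R ^ j) * fps_X ^ j) * sv ^ Suc (2 * i)"
    by (simp add: algebra_simps flip: fps_const_mult fps_const_power)
  also have "\<dots> $ a $ b = (if a = 2 * i \<and> b = j then Z ^ (i * j) else 0) +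
      (if a = Suc (2 * i) \<and> b = j then Z ^ (i * j) * R ^ j else 0)"
    by (simp add: fps_X_power_nth del: power_Suc fps_const_mult fps_const_power)
  also have "\<dots> = (if (i, j) = (a div 2, b) then pair_series fls_X a b else 0)"
    unfolding pair_series_def Z_def R_def by (auto elim: oddE evenE)
  finally show ?thesis unfolding Z R .
qed

section \<open>Eulerian polynomials at s^2 and t\<close>

lemma compose_X_square_mult_power:
  fixes F :: "'a::idom fps"
  shows "(F * (1 - fps_X) ^ m) oo fps_X\<^sup>2 = (F oo fps_X\<^sup>2) * (1 - fps_X\<^sup>2) ^ m"
proof -
  have 0: "(fps_X\<^sup>2 :: 'a fps) $ 0 = 0" by (simp add: fps_X_power_nth)
  have "(1 - fps_X :: 'a fps) oo fps_X\<^sup>2 = 1 - fps_X\<^sup>2"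
    using fps_X_power_compose[OF 0, of 1] by (simp add: fps_compose_sub_distrib)
  then show ?thesis
    by (simp add: fps_compose_mult_distrib[OF 0] fps_compose_power[OF 0, symmetric])
qed

lemma eulerian_A_X_square:
  "eulerian_A n ((fps_X :: 'a::idom fps)\<^sup>2) = (Abs_fps (\<lambda>i. of_nat (i ^ n)) oo fps_X\<^sup>2) * (1 - fps_X\<^sup>2) ^ (n + 1)"
proof -
  have 0: "(fps_X\<^sup>2 :: 'a fps) $ 0 = 0" by (simp add: fps_X_power_nth)
  have "eulerian_A n ((fps_X :: 'a fps)\<^sup>2) = eulerian_A n fps_X oo fps_X\<^sup>2"
    by (simp add: eulerian_A_def fps_compose_sum_distrib fps_X_power_compose[OF 0] del: power_Suc)
  then show ?thesis
    by (simp only: eulerian_A_gf compose_X_square_mult_power of_nat_power)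
qed

lemma eulerian_A_fps_const:
  "eulerian_A n (fps_const (fps_X :: 'a::comm_ring_1 fps)) =
    fps_const (Abs_fps (\<lambda>j. of_nat (j ^ n))) * (1 - fps_const fps_X) ^ (n + 1)"
proof -
  have "eulerian_A n (fps_const (fps_X :: 'a fps)) = fps_const (eulerian_A n fps_X)"
    by (simp add: eulerian_A_def fps_const_sum)
  then show ?thesis
    by (simp only: eulerian_A_gf of_nat_power fps_const_mult[symmetric] fps_const_power[symmetric]
        fps_const_one_minus)
qed

lemma eulerian_B_compose_X_square:
  "eulerian_B n oo (fps_X :: 'a::idom fps)\<^sup>2 =
    (Abs_fps (\<lambda>i. of_nat ((2 * i + 1) ^ n)) oo fps_X\<^sup>2) * (1 - fps_X\<^sup>2) ^ (n + 1)"
proof -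
  have "(\<lambda>i. of_nat ((2 * i + 1) ^ n)) = (\<lambda>i. (2 * of_nat i + 1) ^ n :: 'a)"
    by (simp add: fun_eq_iff add.commute)
  then show ?thesis
    unfolding eulerian_B_def compose_X_square_mult_power by (simp only:)
qed

abbreviation (input) const3 :: "rat fls \<Rightarrow> series" where
  "const3 c \<equiv> fps_const (fps_const (fps_const c))"

lemma const3_divide_of_nat:
  assumes "m > 0"
  shows "const3 c / of_nat m = const3 (c / of_nat m)"
proof (rule series_divide_eqI)
  show "const3 (c / of_nat m) * of_nat m = const3 c"
    unfolding fps_of_nat[symmetric] fps_const_mult using assms by simp
qed (use assms in simp)

lemma prod_mset_const3: "(\<Prod>k\<in>#M. 1 - (- yv) ^ k) = const3 (\<Prod>k\<in>#M. 1 - (- fls_X) ^ k)"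
proof (induction M)
  case (add k M)
  have "1 - (- yv) ^ k = const3 (1 - (- fls_X) ^ k)"
    by (simp add: fps_const_one_minus flip: fps_const_power fps_const_neg)
  then show ?case
    using add by (simp only: image_mset_add_mset prod_mset.add_mset fps_const_mult)
qed simp

text \<open>The denominators cancel the powers in \<open>f\<close> and \<open>g\<close>, leaving a
  series in s^2 with coefficients \<open>u\<close> times a series in t with coefficients
  \<open>v\<close>. Both sums of (b) have this form, the first with powers of i and the second with
  powers of 2 i + 1 as \<open>u i\<close>.\<close>

lemma nth_eulerian_term:
  assumes f: "f = (Abs_fps (\<lambda>i. of_nat (u i)) oo sv\<^sup>2) * (1 - sv\<^sup>2) ^ m"
    and g: "g = fps_const (Abs_fps (\<lambda>j. of_nat (v j))) * (1 - tv) ^ l"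
    and z: "z > 0"
  shows "(const3 c / of_nat z * (f * g / ((1 - sv\<^sup>2) ^ m * (1 - tv) ^ l)) * const3 d) $ a $ j =
    (if even a then fps_const (c / of_nat z * d * of_nat (u (a div 2)) * of_nat (v j)) else 0)"
proof -
  let ?F = "Abs_fps (\<lambda>i. of_nat (u i)) :: series"
  let ?G = "Abs_fps (\<lambda>j. of_nat (v j)) :: rat fls fps fps"
  have q: "f * g / ((1 - sv\<^sup>2) ^ m * (1 - tv) ^ l) = (?F oo sv\<^sup>2) * fps_const ?G"
    by (rule series_divide_eqI) (simp add: fps_power_zeroth fps_X_power_nth, simp only: f g mult_ac)
  have "const3 (c / of_nat z) * ((?F oo sv\<^sup>2) * fps_const ?G) * const3 d =
      fps_const (fps_const (fps_const (c / of_nat z * d)) * ?G) * (?F oo sv\<^sup>2)"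
    by (simp add: mult_ac flip: fps_const_mult)
  also have "\<dots> $ a $ j = fps_const (c / of_nat z * d) * (?G * (?F oo sv\<^sup>2) $ a) $ j"
    by (simp only: fps_mult_left_const_nth mult.assoc)
  also have "\<dots> = (if even a then fps_const (c / of_nat z * d * of_nat (u (a div 2)) * of_nat (v j)) else 0)"
    by (simp add: fps_nth_compose_X_square mult_ac fps_of_nat[symmetric])
  finally show ?thesis
    unfolding q const3_divide_of_nat[OF z] .
qed

theorem theorem5p2:
  fixes s y t x :: series
  assumes "s = fps_X"
    and "t = fps_const fps_X"
    and "x = fps_const (fps_const fps_X)"
    and "y = fps_const (fps_const (fps_const fls_X))"
  shows
    "formally_summable_on
       (\<lambda>n. (1 + s\<^sup>2) ^ n / (1 - s\<^sup>2) ^ (n - 1) * ((1 + y * t) / (1 - t)) ^ (n + 1)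
            * (P_udr_ipk_ides n (2 * s / (1 + s\<^sup>2))
                 ((1 + y)\<^sup>2 * t / ((y + t) * (1 + y * t))) ((y + t) / (1 + y * t))
               / (2 * (1 - s)\<^sup>2 * (1 + y))) * x ^ n) {1..}
     \<and> formally_summable_on
       (\<lambda>(i, j). ((1 + x) * (1 + y * x) / ((1 - y * x) * (1 - x))) ^ (i * j)
            * (1 + s * ((1 + y * x) / (1 - x)) ^ j) * s ^ (2 * i) * t ^ j)
       (UNIV :: (nat \<times> nat) set)
     \<and> 1 / ((1 - s) * (1 - t))
       + formal_sum
       (\<lambda>n. (1 + s\<^sup>2) ^ n / (1 - s\<^sup>2) ^ (n - 1) * ((1 + y * t) / (1 - t)) ^ (n + 1)
            * (P_udr_ipk_ides n (2 * s / (1 + s\<^sup>2))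
                 ((1 + y)\<^sup>2 * t / ((y + t) * (1 + y * t))) ((y + t) / (1 + y * t))
               / (2 * (1 - s)\<^sup>2 * (1 + y))) * x ^ n) {1..}
       = formal_sum
       (\<lambda>(i, j). ((1 + x) * (1 + y * x) / ((1 - y * x) * (1 - x))) ^ (i * j)
            * (1 + s * ((1 + y * x) / (1 - x)) ^ j) * s ^ (2 * i) * t ^ j)
       (UNIV :: (nat \<times> nat) set)
     \<and> (\<forall>n\<ge>1.
       (1 + s\<^sup>2) ^ n / (1 - s\<^sup>2) ^ (n - 1) * ((1 + y * t) / (1 - t)) ^ (n + 1)
            * (P_udr_ipk_ides n (2 * s / (1 + s\<^sup>2))
                 ((1 + y)\<^sup>2 * t / ((y + t) * (1 + y * t))) ((y + t) / (1 + y * t))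
               / (2 * (1 - s)\<^sup>2 * (1 + y)))
       = (\<Sum>p | p \<in> partitions_of n \<and> (\<forall>k\<in>#p. odd k).
            2 ^ size p / of_nat (z_part p)
            * (eulerian_A (size p) (s\<^sup>2) * eulerian_A (size p) t
               / ((1 - s\<^sup>2) ^ (size p + 1) * (1 - t) ^ (size p + 1)))
            * (\<Prod>k\<in>#p. 1 - (- y) ^ k))
       + s * (\<Sum>p | p \<in> partitions_of n.
            1 / of_nat (z_part p)
            * ((eulerian_B (num_odd_parts p) oo s\<^sup>2) * eulerian_A (size p) t
               / ((1 - s\<^sup>2) ^ (num_odd_parts p + 1) * (1 - t) ^ (size p + 1)))
            * (\<Prod>k\<in>#p. 1 - (- y) ^ k)))"
    (is "formally_summable_on (\<lambda>n. ?L n * x ^ n) _ \<and> formally_summable_on ?Z _ \<and> ?C + _ = _ \<and>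
         (\<forall>n\<ge>1. _ = (\<Sum>p\<in>?Odd n. ?T1 p) + s * (\<Sum>p\<in>?All n. ?T2 p))")
proof -
  note vars = assms
  have nth_L: "?L n $ a $ j = fps_const (pair_series fls_X a j $ n)" if "n \<ge> 1" for n a j
    unfolding vars permutation_series[OF that] by (rule nth_updown_barred)
  have nth_Lx: "(?L n * x ^ n) $ a $ b $ c = (if n = c then pair_series fls_X a b $ c else 0)"
    if "n \<in> {1..}" for n a b c
  proof -
    have "?L n * x ^ n = ?L n * fps_const (fps_const (fps_X ^ n))"
      by (simp add: vars)
    then have "(?L n * x ^ n) $ a $ b = ?L n $ a $ b * fps_X ^ n"
      by (simp only: fps_mult_right_const_nth)
    then show ?thesis
      using nth_L[of n a b] that by (simp add: fps_X_power_nth)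
  qed
  have nth_Z: "?Z ij $ a $ b $ c = (if ij = (a div 2, b) then pair_series fls_X a b $ c else 0)"
    for ij a b c
  proof (cases ij)
    case (Pair i j)
    then show ?thesis
      unfolding vars by (simp only: case_prod_conv nth_pair_term) simp
  qed
  have supp_L: "n = c" if "n \<in> {1..}" "(?L n * x ^ n) $ a $ b $ c \<noteq> 0" for n a b c
    using that(2) unfolding nth_Lx[OF that(1)] by (rule contrapos_np) (simp only: if_False)
  have supp_Z: "ij = (a div 2, b)" if "ij \<in> UNIV" "?Z ij $ a $ b $ c \<noteq> 0" for ij a b c
    using that(2) unfolding nth_Z by (rule contrapos_np) (simp only: if_False)
  have sum_L: "formally_summable_on (\<lambda>n. ?L n * x ^ n) {1..}"
    by (rule formal_sum_single(1)[where g = "\<lambda>_ _ c. c"]) (rule supp_L)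
  have sum_Z: "formally_summable_on ?Z UNIV"
    by (rule formal_sum_single(1)[where g = "\<lambda>a b _. (a div 2, b)"]) (rule supp_Z)
  have nth_sum_L: "formal_sum (\<lambda>n. ?L n * x ^ n) {1..} $ a $ b $ c =
      (if c \<in> {1..} then (?L c * x ^ c) $ a $ b $ c else 0)" for a b c
    by (rule formal_sum_single(2)[where g = "\<lambda>_ _ c. c"]) (rule supp_L)
  have "formal_sum ?Z UNIV $ a $ b $ c =
      (if (a div 2, b) \<in> UNIV then ?Z (a div 2, b) $ a $ b $ c else 0)" for a b c
    by (rule formal_sum_single(2)[where g = "\<lambda>a b _. (a div 2, b)"]) (rule supp_Z)
  then have nth_sum_Z: "formal_sum ?Z UNIV $ a $ b $ c = pair_series fls_X a b $ c" for a b c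
    by (simp only: nth_Z UNIV_I if_True refl)
  have main_a: "?C + formal_sum (\<lambda>n. ?L n * x ^ n) {1..} = formal_sum ?Z UNIV"
  proof (intro fps_ext)
    fix a b c
    have C: "?C $ a $ b = 1" unfolding vars by (rule inverse_geometric_product)
    show "(?C + formal_sum (\<lambda>n. ?L n * x ^ n) {1..}) $ a $ b $ c = formal_sum ?Z UNIV $ a $ b $ c"
    proof (cases "c \<in> {1..}")
      case True
      then show ?thesis
        by (simp only: fps_add_nth C nth_sum_L nth_sum_Z if_True nth_Lx[OF True]) simp
    next
      case False
      \<comment> \<open>The formal sum starts at n = 1, so \<open>?C\<close> alone accounts for this
        coefficient.\<close>
      then have "c = 0" by simp
      then show ?thesis
        using False by (simp only: fps_add_nth C nth_sum_L nth_sum_Z if_False) simp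
    qed
  qed
  have main_b: "?L n = (\<Sum>p\<in>?Odd n. ?T1 p) + s * (\<Sum>p\<in>?All n. ?T2 p)" if n: "n \<ge> 1" for n
  proof (intro fps_ext)
    fix a j c
    let ?w = "\<lambda>p. \<Prod>k\<in>#p. 1 - (- fls_X :: rat fls) ^ k"
    have z: "z_part p > 0" if "p \<in> partitions_of n" for p
      using that by (auto simp: partitions_of_def intro: z_part_pos)
    have T1: "?T1 p $ a $ j = (if even a then fps_const (2 ^ size p / of_nat (z_part p) * ?w p *
        of_nat ((a div 2) ^ size p) * of_nat (j ^ size p)) else 0)" if "p \<in> partitions_of n" for p a
    proof -
      have "const3 (2 ^ size p) = 2 ^ size p"
        by (simp add: numeral_fps_const)
      from nth_eulerian_term[OF eulerian_A_X_square eulerian_A_fps_const z[OF that],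
          where c = "2 ^ size p" and d = "?w p", unfolded this]
      show ?thesis unfolding vars prod_mset_const3 .
    qed
    have T2: "?T2 p $ a $ j = (if even a then fps_const (1 / of_nat (z_part p) * ?w p *
        of_nat ((2 * (a div 2) + 1) ^ num_odd_parts p) * of_nat (j ^ size p)) else 0)" if "p \<in> partitions_of n" for p a
    proof -
      from nth_eulerian_term[OF eulerian_B_compose_X_square eulerian_A_fps_const z[OF that],
          where c = 1 and d = "?w p", unfolded fps_const_1_eq_1]
      show ?thesis unfolding vars prod_mset_const3 .
    qed
    have "((\<Sum>p\<in>?Odd n. ?T1 p) + s * (\<Sum>p\<in>?All n. ?T2 p)) $ a $ j =
        (\<Sum>p\<in>?Odd n. ?T1 p $ a $ j) + (if a = 0 then 0 else \<Sum>p\<in>?All n. ?T2 p $ (a - 1) $ j)"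
      by (simp add: assms(1) fps_sum_nth)
    also have "(\<Sum>p\<in>?Odd n. ?T1 p $ a $ j) = (if even a then fps_const (pair_series fls_X a j $ n) else 0)"
    proof -
      have "(\<Sum>p\<in>?Odd n. ?T1 p $ a $ j) =
          (\<Sum>p\<in>?Odd n. if even a then fps_const (2 ^ size p / of_nat (z_part p) * ?w p *
             of_nat ((a div 2) ^ size p) * of_nat (j ^ size p)) else 0)"
        by (rule sum.cong[OF refl], rule T1) (simp only: mem_Collect_eq)
      then show ?thesis
        by (cases "even a") (simp_all only: pair_series_nth_even fps_const_sum if_True if_False sum.neutral_const)
    qed
    \<comment> \<open>The factor s shifts the exponent by one, so this sum serves odd
      \<open>a\<close>. Writing \<open>Suc (a - 1)\<close> for \<open>a\<close> keeps the equation
      true at \<open>a = 0\<close>.\<close>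
    also have "(\<Sum>p\<in>?All n. ?T2 p $ (a - 1) $ j) =
        (if even (a - 1) then fps_const (pair_series fls_X (Suc (a - 1)) j $ n) else 0)"
    proof -
      have "(\<Sum>p\<in>?All n. ?T2 p $ (a - 1) $ j) =
          (\<Sum>p\<in>?All n. if even (a - 1) then fps_const (1 / of_nat (z_part p) * ?w p *
             of_nat ((2 * ((a - 1) div 2) + 1) ^ num_odd_parts p) * of_nat (j ^ size p)) else 0)"
        by (rule sum.cong[OF refl], rule T2) (simp only: mem_Collect_eq)
      moreover have "2 * ((a - 1) div 2) + 1 = Suc (a - 1)" if "even (a - 1)" using that by simp
      ultimately show ?thesis
        by (cases "even (a - 1)")
          (simp_all only: pair_series_nth_odd even_Suc not_not fps_const_sum if_True if_False
            sum.neutral_const Collect_mem_eq)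
    qed
    also have "(if even a then fps_const (pair_series fls_X a j $ n) else 0) +
        (if a = 0 then 0
         else if even (a - 1) then fps_const (pair_series fls_X (Suc (a - 1)) j $ n) else 0) =
        fps_const (pair_series fls_X a j $ n)"
      by (cases a) simp_all
    finally show "?L n $ a $ j $ c = ((\<Sum>p\<in>?Odd n. ?T1 p) + s * (\<Sum>p\<in>?All n. ?T2 p)) $ a $ j $ c"
      using nth_L[OF n, of a j] by simp
  qed
  show ?thesis
    by (intro conjI allI impI sum_L sum_Z main_a main_b)
qed

end
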